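(* Assume the standing conditions ($\mathcal L$), ($E\mathcal S$), ($G|\Gamma$), ($\mathcal L_0$) of the context. Let $n$ be the large-sample parameter and $\mathtt x=\log n$. Let $\Omega(\mathtt x)$ be a random event with $P(\Omega(\mathtt x))\ge1-e^{-\mathtt x}$ on which $\sigma^{-2}\varepsilon^\top\mathbb H_G^{-1}\varepsilon\le z^2(B_{\mathcal S|G},\mathtt x)$. Let $\mathtt r_G$ be such that $\Upsilon_0\supseteq\{\upsilon:\|\mathcal D_G(\upsilon-\upsilon^*_G)\|\le\mathtt r_G\}$, $3\delta_{3,G}(\mathtt r_G)/\mathtt r_G^2\le\rho\le1/2$ and $(1-\rho)\mathtt r_G\ge z(B_{\mathcal S|G},\mathtt x)$. Let $Q$ be a linear mapping from $\mathcal X^d$ to $\mathbb R^m$ and $B_{Q|G}=\sigma^{-2}Q\,\mathbb A_G\,\mathcal S^2\,\mathbb A_G^\top Q^\top$. Then on a random event $\Omega_1(\mathtt x)$ with $P(\Omega_1(\mathtt x))\ge1-2/n$ it holds $$\|Q(\tilde f_G-f^*_G)\|\le z(B_{Q|G},\mathtt x)+\|Q\,\mathbb D_G^{-1}\|\sqrt{\delta_{3,G}(\mathtt r_G)} .$$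
   Context: Model. $\mathcal X^d,\mathcal Y^d$ are finite-dimensional Euclidean spaces, $q=\dim\mathcal Y^d$, $\Upsilon^d=\mathcal X^d\times\mathcal Y^d$, with points $\upsilon=(f,g)$; $A:\mathcal X^d\to\mathcal Y^d$ is a known smooth, possibly nonlinear operator; $\sigma,\lambda>0$. One observes a random $Y\in\mathcal Y^d$ with $EY=g^*:=A(f^* )$ for an unknown $f^*$; $\varepsilon:=\sigma^{-1}(Y-EY)$. Given $f_0\in\mathcal X^d$, $g_0\in\mathcal Y^d$ and prior precision operators $G^2$ on $\mathcal X^d$, $\Gamma^2$ on $\mathcal Y^d$ (symmetric, positive), put $$\mathcal L(\upsilon)=-\tfrac1{2\sigma^2}\|Y-g\|^2-\tfrac\lambda2\|g-A(f)\|^2,\quad \mathcal L_G(\upsilon)=\mathcal L(\upsilon)-\tfrac12\|G(f-f_0)\|^2-\tfrac12\|\Gamma(g-g_0)\|^2 .$$ $\Upsilon^\circ\subseteq\Upsilon^d$ is the parameter set and $\Upsilon_0\subseteq\Upsilon^\circ$ a local set. $\tilde\upsilon_G=(\tilde f_G,\tilde g_G)=\arg\max_{\Upsilon^\circ}\mathcal L_G$ (penalized MLE), $\upsilon^*_G=(f^*_G,g^*_G)=\arg\max_{\Upsilon^\circ}E\mathcal L_G$. The large-sample parameter $n$ is e.g. $n=\sigma^{-2}$. Matrices. $\mathcal F_G(\upsilon)=-\nabla^2E\mathcal L_G(\upsilon)$, $\mathcal F(\upsilon)=-\nabla^2E\mathcal L(\upsilon)$, $\mathcal F_G=\mathcal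 F_G(\upsilon^*_G)$, $\mathcal D_G=\mathcal F_G^{1/2}$; $F_G(\upsilon),F(\upsilon)$ are the $ff$-blocks of $\mathcal F_G(\upsilon),\mathcal F(\upsilon)$; $\mathbb D_G^{-2}$, $\mathbb A_G$, $\mathbb H_G^{-1}$ are the $ff$-, $fg$- and $gg$-blocks of $\mathcal F_G^{-1}$, and $\mathbb D_G^{-1}$ is the positive square root of $\mathbb D_G^{-2}$. Standing conditions. ($\mathcal L$): $\Upsilon^\circ$ is open and convex and $E\mathcal L_G$ is concave on it. ($E\mathcal S$): there are a positive symmetric $q\times q$ matrix $\mathcal S$ and constants $\mathtt g>0$, $\nu_0\ge1$ with $\mathrm{Var}(\varepsilon)\le\mathcal S^2$ and $\sup_{u\in\mathcal Y^d}\log E\exp\{t\langle u,\varepsilon\rangle/\|\mathcal Su\|\}\le\nu_0^2t^2/2$ for $|t|\le\mathtt g$ (with $\mathtt g=\infty$ where $z$ below is used). ($G|\Gamma$): $g_0=A(f_0)$ and for a constant $C_{G|\Gamma}$, $\|\Gamma\{A(f^* )-g_0\}\|^2\le C_{G|\Gamma}\|G(f^*-f_0)\|^2$ and $\mathrm{tr}(\sigma^2\Gamma^2+I_q)^{-1}\le C_{G|\Gamma}\,\mathrm{tr}\{F_G^{-1}(\upsilon_G^* )F(\upsilon_G^* )\}$. ($\mathcal L_0$): for the local set $\Upsilon_0$ and a set $\mathcal U^\circ\subseteq\Upsilon^d$, the directional derivatives $\partial_\alpha^mA(f)=\frac{d^m}{dt^m}A(f+t\alpha)|_{t=0}$, $m=3,4$,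 exist and are bounded uniformly over $(f,g)\in\Upsilon_0$, $(\alpha,\beta)\in\mathcal U^\circ$. Quantities. $z(B,\mathtt x)=\sqrt{\mathrm{tr}B}+\sqrt{2\lambda_{\max}(B)\mathtt x}$; $B_{\mathcal S|G}=\sigma^{-2}\mathcal S\,\mathbb H_G^{-1}\mathcal S$. With $\Phi(\upsilon)=\frac\lambda2\|g-A(f)\|^2$ and $\partial_u^3\Phi(\upsilon)=\frac{d^3}{dt^3}\Phi(\upsilon+tu)|_{t=0}$, $$\delta_{3,G}(\mathtt r)=\sup_{\upsilon:\|\mathcal D_G(\upsilon-\upsilon^*_G)\|\le\mathtt r}\ \sup_{u:\|\mathcal D_Gu\|\le\mathtt r}|\partial_u^3\Phi(\upsilon)| .$$
   Formalization: The bound is proved with ν_0·z(B_{Q|G},x) in place of z(B_{Q|G},x); for ν_0=1 this is the stated bound, while for ν_0>1 the bound as stated fails (e.g. A=id with suitable bounded three-point noise). *)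

theory Defs
  imports "HOL-Probability.Probability"
begin

section \<open>Operators on Euclidean spaces\<close>

definition self_adjoint :: "('v::euclidean_space \<Rightarrow> 'v) \<Rightarrow> bool" where
  "self_adjoint T \<longleftrightarrow> linear T \<and> (\<forall>x y. T x \<bullet> y = x \<bullet> T y)"

definition pos_semidef :: "('v::euclidean_space \<Rightarrow> 'v) \<Rightarrow> bool" where
  "pos_semidef T \<longleftrightarrow> self_adjoint T \<and> (\<forall>x. 0 \<le> x \<bullet> T x)"

definition pos_def :: "('v::euclidean_space \<Rightarrow> 'v) \<Rightarrow> bool" where
  "pos_def T \<longleftrightarrow> self_adjoint T \<and> (\<forall>x. x \<noteq> 0 \<longrightarrow> 0 < x \<bullet> T x)"

definition is_pos_sqrt :: "('v::euclidean_space \<Rightarrow> 'v) \<Rightarrow> ('v \<Rightarrow> 'v) \<Rightarrow> bool" where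
  "is_pos_sqrt R T \<longleftrightarrow> pos_semidef R \<and> R \<circ> R = T"

definition loewner_le :: "('v::euclidean_space \<Rightarrow> 'v) \<Rightarrow> ('v \<Rightarrow> 'v) \<Rightarrow> bool" where
  "loewner_le S T \<longleftrightarrow> (\<forall>x. x \<bullet> S x \<le> x \<bullet> T x)"

definition op_trace :: "('v::euclidean_space \<Rightarrow> 'v) \<Rightarrow> real" where
  "op_trace T = (\<Sum>b\<in>Basis. b \<bullet> T b)"

text \<open>Largest real eigenvalue; only meant for self-adjoint operators.\<close>

definition lambda_max :: "('v::euclidean_space \<Rightarrow> 'v) \<Rightarrow> real" where
  "lambda_max T = Max {\<mu>. \<exists>v. v \<noteq> 0 \<and> T v = \<mu> *\<^sub>R v}"

text \<open>Blocks of an operator on the product of the signal space (component \<open>f\<close>) and the image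
  space (component \<open>g\<close>).\<close>

definition block_ff :: "('a::euclidean_space \<times> 'b::euclidean_space \<Rightarrow> 'a \<times> 'b) \<Rightarrow> 'a \<Rightarrow> 'a" where
  "block_ff T x = fst (T (x, 0))"

definition block_fg :: "('a::euclidean_space \<times> 'b::euclidean_space \<Rightarrow> 'a \<times> 'b) \<Rightarrow> 'b \<Rightarrow> 'a" where
  "block_fg T y = fst (T (0, y))"

definition block_gg :: "('a::euclidean_space \<times> 'b::euclidean_space \<Rightarrow> 'a \<times> 'b) \<Rightarrow> 'b \<Rightarrow> 'b" where
  "block_gg T y = snd (T (0, y))"

section \<open>Derivatives\<close>

definition gradient :: "('v::euclidean_space \<Rightarrow> real) \<Rightarrow> 'v \<Rightarrow> 'v" where
  "gradient f x = (THE D. GDERIV f x :> D)"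

definition hessian :: "('v::euclidean_space \<Rightarrow> real) \<Rightarrow> 'v \<Rightarrow> 'v \<Rightarrow> 'v" where
  "hessian f x = frechet_derivative (gradient f) (at x)"

primrec C_k :: "nat \<Rightarrow> ('v::euclidean_space \<Rightarrow> 'w::euclidean_space) \<Rightarrow> bool" where
  "C_k 0 F \<longleftrightarrow> continuous_on UNIV F"
| "C_k (Suc k) F \<longleftrightarrow>
     (\<forall>x. F differentiable (at x)) \<and> (\<forall>v. C_k k (\<lambda>x. frechet_derivative F (at x) v))"

definition smooth :: "('v::euclidean_space \<Rightarrow> 'w::euclidean_space) \<Rightarrow> bool" where
  "smooth F \<longleftrightarrow> (\<forall>k. C_k k F)"

definition iter_deriv :: "nat \<Rightarrow> (real \<Rightarrow> 'w::real_normed_vector) \<Rightarrow> real \<Rightarrow> 'w" where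
  "iter_deriv m h = ((\<lambda>h t. vector_derivative h (at t)) ^^ m) h"

definition dir_deriv ::
  "nat \<Rightarrow> ('v::real_normed_vector \<Rightarrow> 'w::real_normed_vector) \<Rightarrow> 'v \<Rightarrow> 'v \<Rightarrow> 'w" where
  "dir_deriv m F x v = iter_deriv m (\<lambda>t. F (x + t *\<^sub>R v)) 0"

definition dir_deriv_exists ::
  "nat \<Rightarrow> ('v::real_normed_vector \<Rightarrow> 'w::real_normed_vector) \<Rightarrow> 'v \<Rightarrow> 'v \<Rightarrow> bool" where
  "dir_deriv_exists m F x v \<longleftrightarrow>
     (\<forall>k<m. \<forall>\<^sub>F t in nhds 0. iter_deriv k (\<lambda>t. F (x + t *\<^sub>R v)) differentiable (at t))"

section \<open>The model\<close>

definition log_lik ::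
  "real \<Rightarrow> real \<Rightarrow> ('a::euclidean_space \<Rightarrow> 'b::euclidean_space) \<Rightarrow> 'b \<Rightarrow> 'a \<times> 'b \<Rightarrow> real" where
  "log_lik \<sigma> lam A y \<upsilon> =
     - (1 / (2 * \<sigma>\<^sup>2)) * (norm (y - snd \<upsilon>))\<^sup>2 - (lam / 2) * (norm (snd \<upsilon> - A (fst \<upsilon>)))\<^sup>2"

definition pen_log_lik ::
  "real \<Rightarrow> real \<Rightarrow> ('a::euclidean_space \<Rightarrow> 'b::euclidean_space) \<Rightarrow>
   ('a \<Rightarrow> 'a) \<Rightarrow> 'a \<Rightarrow> ('b \<Rightarrow> 'b) \<Rightarrow> 'b \<Rightarrow> 'b \<Rightarrow> 'a \<times> 'b \<Rightarrow> real" where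
  "pen_log_lik \<sigma> lam A G f0 \<Gamma> g0 y \<upsilon> =
     log_lik \<sigma> lam A y \<upsilon> - (1/2) * (norm (G (fst \<upsilon> - f0)))\<^sup>2 - (1/2) * (norm (\<Gamma> (snd \<upsilon> - g0)))\<^sup>2"

definition Phi ::
  "real \<Rightarrow> ('a::euclidean_space \<Rightarrow> 'b::euclidean_space) \<Rightarrow> 'a \<times> 'b \<Rightarrow> real" where
  "Phi lam A \<upsilon> = (lam / 2) * (norm (snd \<upsilon> - A (fst \<upsilon>)))\<^sup>2"

definition covariance ::
  "'w measure \<Rightarrow> ('w \<Rightarrow> 'b::euclidean_space) \<Rightarrow> 'b \<Rightarrow> 'b" where
  "covariance M X u =
     (\<integral>\<omega>. (u \<bullet> (X \<omega> - (\<integral>\<omega>'. X \<omega>' \<partial>M))) *\<^sub>R (X \<omega> - (\<integral>\<omega>'. X \<omega>' \<partial>M)) \<partial>M)"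

section \<open>Standing conditions\<close>

definition cond_L :: "('v::euclidean_space) set \<Rightarrow> ('v \<Rightarrow> real) \<Rightarrow> bool" where
  "cond_L U ELG \<longleftrightarrow> open U \<and> convex U \<and> concave_on U ELG"

text \<open>Integrability is spelled out because the Bochner integral of a non-integrable function
  is \<open>0\<close>, which would make the bounds void.\<close>

definition cond_ES ::
  "'w measure \<Rightarrow> ('w \<Rightarrow> 'b::euclidean_space) \<Rightarrow> ('b \<Rightarrow> 'b) \<Rightarrow> real \<Rightarrow> ereal \<Rightarrow> bool" where
  "cond_ES M eps S \<nu>0 gg \<longleftrightarrow>
     pos_def S \<and> 0 < gg \<and> 1 \<le> \<nu>0 \<and>
     integrable M (\<lambda>\<omega>. (norm (eps \<omega>))\<^sup>2) \<and> loewner_le (covariance M eps) (S \<circ> S) \<and>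
     (\<forall>u t. u \<noteq> 0 \<longrightarrow> ereal \<bar>t\<bar> \<le> gg \<longrightarrow>
        integrable M (\<lambda>\<omega>. exp (t * (u \<bullet> eps \<omega>) / norm (S u))) \<and>
        ln (\<integral>\<omega>. exp (t * (u \<bullet> eps \<omega>) / norm (S u)) \<partial>M) \<le> \<nu>0\<^sup>2 * t\<^sup>2 / 2)"

text \<open>\<open>FG\<close> and \<open>F\<close> are the \<open>ff\<close>-blocks of the two information operators at the
  maximiser of the expected penalised log-likelihood.\<close>

definition cond_GGamma ::
  "real \<Rightarrow> ('a::euclidean_space \<Rightarrow> 'b::euclidean_space) \<Rightarrow> ('a \<Rightarrow> 'a) \<Rightarrow> 'a \<Rightarrow> ('b \<Rightarrow> 'b) \<Rightarrow> 'b \<Rightarrow>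
   'a \<Rightarrow> ('a \<Rightarrow> 'a) \<Rightarrow> ('a \<Rightarrow> 'a) \<Rightarrow> real \<Rightarrow> bool" where
  "cond_GGamma \<sigma> A G f0 \<Gamma> g0 fstar FG F C \<longleftrightarrow>
     g0 = A f0 \<and>
     (norm (\<Gamma> (A fstar - g0)))\<^sup>2 \<le> C * (norm (G (fstar - f0)))\<^sup>2 \<and>
     op_trace (inv (\<lambda>y. \<sigma>\<^sup>2 *\<^sub>R \<Gamma> (\<Gamma> y) + y)) \<le> C * op_trace (inv FG \<circ> F)"

definition cond_L0 ::
  "('a::euclidean_space \<Rightarrow> 'b::euclidean_space) \<Rightarrow> ('a \<times> 'b) set \<Rightarrow> ('a \<times> 'b) set \<Rightarrow> bool" where
  "cond_L0 A U0 V \<longleftrightarrow>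
     (\<exists>K. \<forall>m\<in>{3, 4}. \<forall>(f, g)\<in>U0. \<forall>(\<alpha>, \<beta>)\<in>V.
        dir_deriv_exists m A f \<alpha> \<and> norm (dir_deriv m A f \<alpha>) \<le> K)"

section \<open>Quantities in the bound\<close>

text \<open>This quantile is calibrated to \<open>\<nu>0 = 1\<close> in \<^const>\<open>cond_ES\<close>. Replacing \<open>S\<close> by \<open>\<nu>0 S\<close>
  reduces general \<open>\<nu>0\<close> to that case and multiplies the quantile by \<open>\<nu>0\<close>.\<close>

definition zq :: "('v::euclidean_space \<Rightarrow> 'v) \<Rightarrow> real \<Rightarrow> real" where
  "zq B x = sqrt (op_trace B) + sqrt (2 * lambda_max B * x)"

definition delta3 ::
  "real \<Rightarrow> ('a::euclidean_space \<Rightarrow> 'b::euclidean_space) \<Rightarrow> ('a \<times> 'b \<Rightarrow> 'a \<times> 'b) \<Rightarrow> 'a \<times> 'b \<Rightarrow>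
   real \<Rightarrow> real" where
  "delta3 lam A DG \<upsilon>s r =
     (SUP \<upsilon>\<in>{\<upsilon>. norm (DG (\<upsilon> - \<upsilon>s)) \<le> r}. SUP u\<in>{u. norm (DG u) \<le> r}.
        \<bar>dir_deriv 3 (Phi lam A) \<upsilon> u\<bar>)"

end

theory Submission
  imports Defs
begin

text \<open>
  The data enter the penalised log-likelihood only through a linear functional of the parameter: up
  to terms that are free of \<open>\<upsilon>\<close>, it equals \<open>ELG \<upsilon> + a \<bullet> \<upsilon>\<close> with \<open>a = (0, \<sigma>\<^sup>-\<^sup>1 eps)\<close>. So \<open>\<upsilon>s\<close>
  maximises the concave function \<open>ELG\<close>, while the penalised MLE maximises a linear tilt of it. All
  terms of \<open>ELG\<close> other than \<open>- Phi\<close> are quadratic; hence the quantity \<open>\<delta>\<close> built from the third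
  derivatives of \<open>Phi\<close> controls how far \<open>ELG\<close> is from its quadratic approximation on the ellipsoid
  \<open>|DG (\<upsilon> - \<upsilon>s)| \<le> rG\<close>.

  The Newton step \<open>u0 = FG\<^sup>-\<^sup>1 a\<close> satisfies \<open>|DG u0|\<^sup>2 = \<sigma>\<^sup>-\<^sup>2 (eps \<bullet> HGinv eps)\<close>, so on \<open>\<Omega>\<close> it lies in the
  ellipsoid of radius \<open>(1 - \<rho>) rG\<close>. The bound \<open>3 \<delta> \<le> \<rho> rG\<^sup>2\<close> then makes the tilted function
  decrease beyond the boundary of the ellipsoid of radius \<open>rG\<close>
  (\<open>tilted_smaller_outside_ball\<close>): slopes, and not values, are compared there, since a comparison
  of values would only tolerate a tilt of half the size. Therefore the maximiser exists and lies in
  the ellipsoid. Inside, the values at the maximiser and at the Newton step are compared through the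
  quadratic approximation, which gives \<open>|DG (\<upsilon>tilde - \<upsilon>s - u0)|\<^sup>2 \<le> \<delta>\<close>
  (\<open>tilted_maximum_near_newton_step\<close>). Passing to the first component and applying \<open>Q\<close> costs the
  factor \<open>onorm (Q \<circ> DDinv)\<close> (\<open>norm_projection_le\<close>).

  What is left is \<open>Q (fst u0) = \<sigma>\<^sup>-\<^sup>1 Q (AG eps)\<close>, a linear image of the noise. It is sub-Gaussian with
  matrix \<open>\<nu>0\<^sup>2 BQ\<close>, and its norm exceeds \<open>\<nu>0 zq BQ x\<close> with probability at most \<open>exp (- x) = 1 / n\<close>
  (\<open>subgaussian_norm_deviation\<close>, proved by Gaussian linearisation of the squared norm in an
  orthonormal eigenbasis). Together with the exceptional set of \<open>\<Omega>\<close> this loses \<open>2 / n\<close>.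
\<close>

section \<open>Spectral theorem for self-adjoint operators\<close>

lemma linear_coefficient_zero:
  fixes a b :: real
  assumes "\<And>t. 0 \<le> t * a + t\<^sup>2 * b"
  shows "a = 0"
proof (rule ccontr)
  assume "a \<noteq> 0"
  define c where "c = \<bar>b\<bar> + 1"
  have c: "0 < c" "b < c" by (simp_all add: c_def)
  have "0 \<le> (- a / c) * a + (- a / c)\<^sup>2 * b" by (rule assms)
  also have "\<dots> = (a / c)\<^sup>2 * (b - c)"
    using c(1) by (simp add: field_simps power2_eq_square)
  also have "\<dots> < 0"
    using c \<open>a \<noteq> 0\<close> by (intro mult_pos_neg) auto
  finally show False by simp
qed

text \<open>The Rayleigh quotient attains its maximum on the compact unit sphere of the invariant subspace; a
  maximiser is an eigenvector, because the first variation of the quotient vanishes there in every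
  direction of the subspace, and the residual \<open>\<mu> e - T e\<close> is itself such a direction.\<close>

lemma self_adjoint_eigenvector_in_subspace:
  fixes T :: "'v::euclidean_space \<Rightarrow> 'v"
  assumes T: "self_adjoint T" and W: "subspace W" "W \<noteq> {0}" "\<And>x. x \<in> W \<Longrightarrow> T x \<in> W"
  obtains e \<mu> where "e \<in> W" "norm e = 1" "T e = \<mu> *\<^sub>R e"
proof -
  have lin: "linear T" and sym: "\<And>x y. T x \<bullet> y = x \<bullet> T y"
    using T by (auto simp: self_adjoint_def)
  let ?K = "W \<inter> sphere 0 1"
  obtain w where "w \<in> W" "w \<noteq> 0" using W subspace_0 by blast
  then have "inverse (norm w) *\<^sub>R w \<in> ?K" using W(1) by (simp add: subspace_scale)
  then have ne: "?K \<noteq> {}" by blast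
  have "compact ?K"
    using closed_subspace[OF W(1)] by (simp add: closed_Int_compact)
  moreover have "continuous_on ?K (\<lambda>x. x \<bullet> T x)"
    using lin by (intro continuous_intros linear_continuous_on_compose[of _ "\<lambda>x. x"]) auto
  ultimately obtain e where e: "e \<in> ?K" and max: "\<And>y. y \<in> ?K \<Longrightarrow> y \<bullet> T y \<le> e \<bullet> T e"
    using continuous_attains_sup[OF _ ne] by metis
  define \<mu> where "\<mu> = e \<bullet> T e"
  have ee: "e \<bullet> e = 1" and eW: "e \<in> W" using e by (auto simp: norm_eq_1)
  have nonneg: "0 \<le> \<mu> * (y \<bullet> y) - y \<bullet> T y" if "y \<in> W" for y
  proof (cases "y = 0")
    case False
    have "inverse (norm y) *\<^sub>R y \<in> ?K" using that False W(1) by (simp add: subspace_scale)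
    from max[OF this] have "y \<bullet> T y / (norm y)\<^sup>2 \<le> \<mu>"
      by (simp add: linear_cmul[OF lin] \<mu>_def power2_eq_square field_simps)
    then show ?thesis using False by (simp add: field_simps power2_norm_eq_inner)
  qed (use linear_0[OF lin] in simp)
  have "T e = \<mu> *\<^sub>R e"
  proof -
    define w where "w = \<mu> *\<^sub>R e - T e"
    have wW: "w \<in> W" using eW W by (simp add: w_def subspace_diff subspace_scale)
    \<comment> \<open>A nonnegative quadratic form that vanishes at \<open>e\<close> is stationary there.\<close>
    have "2 * (w \<bullet> w) = 0"
    proof (rule linear_coefficient_zero)
      fix t :: real
      have "0 \<le> \<mu> * ((e + t *\<^sub>R w) \<bullet> (e + t *\<^sub>R w)) - (e + t *\<^sub>R w) \<bullet> T (e + t *\<^sub>R w)"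
        using eW wW W(1) by (intro nonneg) (simp add: subspace_add subspace_scale)
      also have "\<dots> = t * (2 * (w \<bullet> (\<mu> *\<^sub>R e - T e))) + t\<^sup>2 * (\<mu> * (w \<bullet> w) - w \<bullet> T w)"
        using sym[of w e] ee
        by (simp add: linear_add[OF lin] linear_cmul[OF lin] inner_simps \<mu>_def[symmetric]
            algebra_simps power2_eq_square inner_commute)
      finally show "0 \<le> t * (2 * (w \<bullet> w)) + t\<^sup>2 * (\<mu> * (w \<bullet> w) - w \<bullet> T w)"
        by (simp add: w_def)
    qed
    then show ?thesis by (simp add: w_def)
  qed
  with eW e show thesis by (intro that) auto
qed

definition orthonormal :: "'v::euclidean_space set \<Rightarrow> bool" where
  "orthonormal E \<longleftrightarrow> pairwise orthogonal E \<and> (\<forall>e\<in>E. norm e = 1)"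

lemma orthonormal_independent: "orthonormal E \<Longrightarrow> independent E"
  by (rule pairwise_orthogonal_independent) (auto simp: orthonormal_def)

lemma orthonormal_expansion:
  assumes "orthonormal E" "span E = UNIV"
  shows "(\<Sum>e\<in>E. (e \<bullet> x) *\<^sub>R e) = x"
  using assms orthonormal_independent[OF assms(1)] independent_imp_finite
  by (subst inner_commute, intro orthonormal_basis_expand) (auto simp: orthonormal_def)

text \<open>Take an orthonormal set of eigenvectors of largest cardinality. If it did not span the space, its
  orthogonal complement would be a nonzero invariant subspace and would contribute one more
  eigenvector.\<close>

theorem self_adjoint_orthonormal_eigenbasis:
  fixes T :: "'v::euclidean_space \<Rightarrow> 'v"
  assumes T: "self_adjoint T"
  obtains E \<mu> where "orthonormal E" "span E = UNIV" "\<And>e. e \<in> E \<Longrightarrow> T e = \<mu> e *\<^sub>R e"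
proof -
  have sym: "\<And>x y. T x \<bullet> y = x \<bullet> T y"
    using T by (auto simp: self_adjoint_def)
  define P where "P E \<longleftrightarrow> orthonormal E \<and> (\<forall>e\<in>E. \<exists>m. T e = m *\<^sub>R e)" for E
  have fin: "finite E \<and> card E \<le> DIM('v)" if "P E" for E
    using that orthonormal_independent independent_bound by (auto simp: P_def)
  have "P {}" by (simp add: P_def orthonormal_def)
  then obtain E where E: "P E" and Emax: "\<And>E'. P E' \<Longrightarrow> card E' \<le> card E"
    using ex_has_greatest_nat[of P "{}" card "Suc DIM('v)"] fin by (auto simp: less_Suc_eq_le)
  have "span E = UNIV"
  proof (rule ccontr)
    assume "span E \<noteq> UNIV"
    define W where "W = {y. \<forall>e\<in>E. orthogonal e y}"
    obtain y where y: "y \<noteq> 0" "\<And>z. z \<in> span E \<Longrightarrow> orthogonal y z"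
      using orthogonal_to_subspace_exists[of E] dim_eq_full \<open>span E \<noteq> UNIV\<close>
      by (metis dim_subset_UNIV order_neq_le_trans)
    have "y \<in> W" using y(2) by (auto simp: W_def span_base orthogonal_commute)
    moreover have "T z \<in> W" if "z \<in> W" for z
      unfolding W_def
    proof clarify
      fix e assume "e \<in> E"
      then obtain m where "T e = m *\<^sub>R e" using E by (auto simp: P_def)
      then show "orthogonal e (T z)"
        using that \<open>e \<in> E\<close> by (simp add: W_def orthogonal_def flip: sym)
    qed
    moreover have "subspace W" unfolding W_def by (rule subspace_orthogonal_to_vectors)
    ultimately obtain e m where e: "e \<in> W" "norm e = 1" "T e = m *\<^sub>R e"
      using self_adjoint_eigenvector_in_subspace[OF T, of W] y(1) by (metis singletonD)
    then have "P (insert e E)"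
      using E by (auto simp: P_def orthonormal_def W_def pairwise_insert orthogonal_commute)
    moreover have "e \<notin> E"
      using e by (auto simp: W_def orthogonal_def)
    ultimately show False using Emax[of "insert e E"] fin[OF E] by simp
  qed
  moreover obtain \<mu> where "\<forall>e\<in>E. T e = \<mu> e *\<^sub>R e"
    using E bchoice[of E "\<lambda>e m. T e = m *\<^sub>R e"] by (auto simp: P_def)
  ultimately show thesis using E by (intro that[of E \<mu>]) (auto simp: P_def)
qed

lemma op_trace_orthonormal:
  fixes T :: "'v::euclidean_space \<Rightarrow> 'v"
  assumes lin: "linear T" and E: "orthonormal E" "span E = UNIV"
  shows "op_trace T = (\<Sum>e\<in>E. e \<bullet> T e)"
proof -
  have expand: "T b = (\<Sum>e\<in>E. (e \<bullet> b) *\<^sub>R T e)" for b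
    by (subst orthonormal_expansion[OF E, of b, symmetric])
      (simp add: linear_sum[OF lin] linear_cmul[OF lin])
  have "b \<bullet> T b = (\<Sum>e\<in>E. (e \<bullet> b) * (T e \<bullet> b))" for b
  proof -
    have "b \<bullet> T b = (\<Sum>e\<in>E. (e \<bullet> b) *\<^sub>R T e) \<bullet> b"
      unfolding expand[of b, symmetric] by (rule inner_commute)
    then show ?thesis by (simp only: inner_sum_left inner_scaleR_left)
  qed
  then have "op_trace T = (\<Sum>b\<in>Basis. \<Sum>e\<in>E. (e \<bullet> b) * (T e \<bullet> b))"
    by (simp only: op_trace_def)
  also have "\<dots> = (\<Sum>e\<in>E. \<Sum>b\<in>Basis. (e \<bullet> b) * (T e \<bullet> b))"
    by (rule sum.swap)
  also have "\<dots> = (\<Sum>e\<in>E. e \<bullet> T e)"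
    by (simp only: euclidean_inner[symmetric])
  finally show ?thesis .
qed

text \<open>The maximum that defines \<^const>\<open>lambda_max\<close> is meaningful: every eigenvalue is an entry of the
  diagonal form, so the set of eigenvalues is finite and nonempty.\<close>

lemma lambda_max_eigenbasis:
  fixes T :: "'v::euclidean_space \<Rightarrow> 'v"
  assumes T: "self_adjoint T" and E: "orthonormal E" "span E = UNIV"
    and eig: "\<And>e. e \<in> E \<Longrightarrow> T e = \<mu> e *\<^sub>R e"
  shows "lambda_max T = Max (\<mu> ` E)" "finite E" "E \<noteq> {}"
proof -
  have sym: "\<And>x y. T x \<bullet> y = x \<bullet> T y"
    using T by (auto simp: self_adjoint_def)
  show "finite E" using E(1) orthonormal_independent independent_imp_finite by blast
  show "E \<noteq> {}"
  proof
    assume "E = {}"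
    then have "UNIV = {0::'v}" using E(2) by simp
    moreover obtain b :: 'v where "b \<in> Basis" using nonempty_Basis by blast
    ultimately show False using nonzero_Basis by blast
  qed
  have "{m. \<exists>v. v \<noteq> 0 \<and> T v = m *\<^sub>R v} = \<mu> ` E"
  proof safe
    fix m v assume v: "v \<noteq> 0" "T v = m *\<^sub>R v"
    have "\<exists>e\<in>E. e \<bullet> v \<noteq> 0"
    proof (rule ccontr)
      assume "\<not> ?thesis"
      then have "(\<Sum>e\<in>E. (e \<bullet> v) *\<^sub>R e) = 0" by simp
      with orthonormal_expansion[OF E, of v] v(1) show False by simp
    qed
    then obtain e where e: "e \<in> E" "e \<bullet> v \<noteq> 0" by blast
    have "m * (e \<bullet> v) = \<mu> e * (e \<bullet> v)"
      using sym[of e v, symmetric] unfolding v(2) eig[OF e(1)] inner_scaleR_left inner_scaleR_right .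
    with e have "m = \<mu> e" by simp
    with e(1) show "m \<in> \<mu> ` E" by blast
  next
    fix e assume "e \<in> E"
    then show "\<exists>v. v \<noteq> 0 \<and> T v = \<mu> e *\<^sub>R v"
      using eig E(1) by (intro exI[of _ e]) (auto simp: orthonormal_def)
  qed
  then show "lambda_max T = Max (\<mu> ` E)" by (simp add: lambda_max_def)
qed

lemma pos_semidef_eigenbasis:
  fixes T :: "'v::euclidean_space \<Rightarrow> 'v"
  assumes T: "pos_semidef T"
  obtains E \<mu> where "orthonormal E" "span E = UNIV" "\<And>e. e \<in> E \<Longrightarrow> T e = \<mu> e *\<^sub>R e"
    "finite E" "\<And>e. e \<in> E \<Longrightarrow> 0 \<le> \<mu> e" "\<And>e. e \<in> E \<Longrightarrow> \<mu> e \<le> lambda_max T"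
    "op_trace T = sum \<mu> E" "lambda_max T \<in> \<mu> ` E"
proof -
  have sa: "self_adjoint T" and lin: "linear T" and psd: "\<And>x. 0 \<le> x \<bullet> T x"
    using T by (auto simp: pos_semidef_def self_adjoint_def)
  obtain E \<mu> where E: "orthonormal E" "span E = UNIV" and eig: "\<And>e. e \<in> E \<Longrightarrow> T e = \<mu> e *\<^sub>R e"
    using self_adjoint_orthonormal_eigenbasis[OF sa] by metis
  note lm = lambda_max_eigenbasis[OF sa E eig]
  have mu: "e \<bullet> T e = \<mu> e" if "e \<in> E" for e
    using that E(1) by (simp add: eig orthonormal_def flip: power2_norm_eq_inner)
  have nonneg: "0 \<le> \<mu> e" if "e \<in> E" for e using psd[of e] mu[OF that] by simp
  have le: "\<mu> e \<le> lambda_max T" if "e \<in> E" for e using lm that by simp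
  have "op_trace T = sum \<mu> E"
    using mu by (simp add: op_trace_orthonormal[OF lin E])
  moreover have "lambda_max T \<in> \<mu> ` E" using lm by simp
  ultimately show thesis using that E eig lm(2) nonneg le by blast
qed

lemma lambda_max_nonneg:
  fixes T :: "'v::euclidean_space \<Rightarrow> 'v"
  assumes "pos_semidef T"
  shows "0 \<le> lambda_max T"
  by (rule pos_semidef_eigenbasis[OF assms]) auto

section \<open>Deviation of the norm of a sub-Gaussian vector\<close>

lemma nn_integral_normal_density: "0 < s \<Longrightarrow> (\<integral>\<^sup>+y. ennreal (normal_density m s y) \<partial>lborel) = 1"
  by (subst nn_integral_eq_integral) auto

lemma nn_integral_std_normal_exp_linear:
  "(\<integral>\<^sup>+y. ennreal (std_normal_density y * exp (s * y)) \<partial>lborel) = ennreal (exp (s\<^sup>2 / 2))"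
proof -
  have "std_normal_density y * exp (s * y) = exp (s\<^sup>2 / 2) * normal_density s 1 y" for y
    by (simp add: normal_density_def flip: exp_add) (simp add: field_simps power2_eq_square)
  then show ?thesis
    by (simp add: ennreal_mult nn_integral_cmult nn_integral_normal_density)
qed

lemma nn_integral_std_normal_exp_square:
  assumes "c < 1"
  shows "(\<integral>\<^sup>+y. ennreal (std_normal_density y * exp (c * y\<^sup>2 / 2)) \<partial>lborel) = ennreal (1 / sqrt (1 - c))"
proof -
  have "std_normal_density y * exp (c * y\<^sup>2 / 2)
      = 1 / sqrt (1 - c) * normal_density 0 (1 / sqrt (1 - c)) y" for y
    using assms
    by (simp add: normal_density_def real_sqrt_divide power_divide real_sqrt_mult flip: exp_add)
      (simp add: field_simps)
  then show ?thesis
    using assms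
    by (simp add: ennreal_mult nn_integral_cmult nn_integral_normal_density del: times_divide_eq_left)
qed

text \<open>A squared coordinate is linearised with an auxiliary standard normal variable \<open>\<eta>\<close>:
  \<open>exp (t s\<^sup>2 / 2) = E exp (sqrt t * \<eta> * s)\<close>. This replaces the square of one coordinate by a random
  shift of the linear term \<open>w\<close> along an eigenvector, to which the induction hypothesis applies
  conditionally on \<open>\<eta>\<close>. The remaining Gaussian integral over \<open>\<eta>\<close> gives one factor of the product.
  The shifts accumulate in \<open>w\<close>, which is therefore part of the statement; the case of interest is
  \<open>w = 0\<close>.\<close>

lemma subgaussian_exp_quadratic:
  fixes \<xi> :: "'w \<Rightarrow> 'v::euclidean_space"
  assumes M: "prob_space M" and meas: "\<xi> \<in> borel_measurable M"
    and T: "linear T"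
    and mgf: "\<And>w. (\<integral>\<^sup>+\<omega>. ennreal (exp (w \<bullet> \<xi> \<omega>)) \<partial>M) \<le> ennreal (exp (w \<bullet> T w / 2))"
    and E: "finite E" "orthonormal E" "\<And>e. e \<in> E \<Longrightarrow> T e = \<mu> e *\<^sub>R e"
    and t: "0 \<le> t" "\<And>e. e \<in> E \<Longrightarrow> t * \<mu> e < 1"
    and w: "\<And>e. e \<in> E \<Longrightarrow> e \<bullet> w = 0 \<and> e \<bullet> T w = 0"
  shows "(\<integral>\<^sup>+\<omega>. ennreal (exp (w \<bullet> \<xi> \<omega> + t / 2 * (\<Sum>e\<in>E. (e \<bullet> \<xi> \<omega>)\<^sup>2))) \<partial>M)
    \<le> ennreal ((\<Prod>e\<in>E. 1 / sqrt (1 - t * \<mu> e)) * exp (w \<bullet> T w / 2))"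
  using E t w
proof (induction E arbitrary: w rule: finite_induct)
  case empty
  then show ?case using mgf by simp
next
  case (insert e E)
  interpret prob_space M by fact
  interpret pair_sigma_finite lborel M ..
  note [measurable] = meas
  define P where "P = (\<Prod>e\<in>E. 1 / sqrt (1 - t * \<mu> e))"
  have P: "0 \<le> P" using insert.prems(4) by (auto simp: P_def intro!: prod_nonneg simp: less_imp_le)
  let ?f = "\<lambda>v \<omega>. exp (v \<bullet> \<xi> \<omega> + t / 2 * (\<Sum>e\<in>E. (e \<bullet> \<xi> \<omega>)\<^sup>2))"
  let ?w = "\<lambda>y. w + (sqrt t * y) *\<^sub>R e"
  have IH: "(\<integral>\<^sup>+\<omega>. ennreal (?f (?w y) \<omega>) \<partial>M) \<le> ennreal (P * exp (?w y \<bullet> T (?w y) / 2))" for y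
    unfolding P_def
  proof (rule insert.IH)
    fix d assume "d \<in> E"
    then have "d \<bullet> e = 0"
      using insert.hyps insert.prems(1) by (auto simp: orthonormal_def pairwise_def orthogonal_def)
    then show "d \<bullet> ?w y = 0 \<and> d \<bullet> T (?w y) = 0"
      using insert.prems \<open>d \<in> E\<close>
      by (simp add: inner_simps linear_add[OF T] linear_cmul[OF T])
  qed (use insert.prems in \<open>auto simp: orthonormal_def pairwise_insert\<close>)
  have ee: "e \<bullet> e = 1" using insert.prems(1) by (simp add: orthonormal_def norm_eq_1)
  have quad: "?w y \<bullet> T (?w y) = w \<bullet> T w + t * \<mu> e * y\<^sup>2" for y
    using insert.prems(2)[of e] insert.prems(5)[of e] ee t(1)
    by (simp add: inner_simps linear_add[OF T] linear_cmul[OF T] inner_commute[of w e] power2_eq_square)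
  have mix: "ennreal (exp (w \<bullet> \<xi> \<omega> + t / 2 * (\<Sum>e\<in>insert e E. (e \<bullet> \<xi> \<omega>)\<^sup>2)))
      = (\<integral>\<^sup>+y. ennreal (std_normal_density y * ?f (?w y) \<omega>) \<partial>lborel)" for \<omega>
  proof -
    have "(\<integral>\<^sup>+y. ennreal (std_normal_density y * ?f (?w y) \<omega>) \<partial>lborel)
        = (\<integral>\<^sup>+y. ennreal (?f w \<omega>) * ennreal (std_normal_density y * exp (sqrt t * (e \<bullet> \<xi> \<omega>) * y)) \<partial>lborel)"
      by (intro nn_integral_cong)
        (simp add: ennreal_mult[symmetric] inner_simps exp_add[symmetric] algebra_simps)
    also have "\<dots> = ennreal (?f w \<omega>) * ennreal (exp ((sqrt t * (e \<bullet> \<xi> \<omega>))\<^sup>2 / 2))"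
      by (subst nn_integral_cmult) (simp_all add: nn_integral_std_normal_exp_linear)
    also have "\<dots> = ennreal (exp (w \<bullet> \<xi> \<omega> + t / 2 * (\<Sum>e\<in>insert e E. (e \<bullet> \<xi> \<omega>)\<^sup>2)))"
      using insert.hyps t(1)
      by (simp add: ennreal_mult[symmetric] exp_add[symmetric] power_mult_distrib algebra_simps)
    finally show ?thesis ..
  qed
  have "(\<integral>\<^sup>+\<omega>. ennreal (exp (w \<bullet> \<xi> \<omega> + t / 2 * (\<Sum>e\<in>insert e E. (e \<bullet> \<xi> \<omega>)\<^sup>2))) \<partial>M)
      = (\<integral>\<^sup>+\<omega>. (\<integral>\<^sup>+y. ennreal (std_normal_density y * ?f (?w y) \<omega>) \<partial>lborel) \<partial>M)"
    unfolding mix ..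
  also have "\<dots> = (\<integral>\<^sup>+y. (\<integral>\<^sup>+\<omega>. ennreal (std_normal_density y * ?f (?w y) \<omega>) \<partial>M) \<partial>lborel)"
    by (rule Fubini') measurable
  also have "\<dots> = (\<integral>\<^sup>+y. ennreal (std_normal_density y) * (\<integral>\<^sup>+\<omega>. ennreal (?f (?w y) \<omega>) \<partial>M) \<partial>lborel)"
    by (intro nn_integral_cong) (simp add: ennreal_mult nn_integral_cmult)
  also have "\<dots> \<le> (\<integral>\<^sup>+y. ennreal (std_normal_density y) * ennreal (P * exp (?w y \<bullet> T (?w y) / 2)) \<partial>lborel)"
    by (intro nn_integral_mono mult_left_mono IH) simp
  also have "\<dots> = (\<integral>\<^sup>+y. ennreal (P * exp (w \<bullet> T w / 2)) *
      ennreal (std_normal_density y * exp (t * \<mu> e * y\<^sup>2 / 2)) \<partial>lborel)"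
    using P by (intro nn_integral_cong)
      (simp only: quad, simp add: ennreal_mult[symmetric] add_divide_distrib exp_add mult_ac)
  also have "\<dots> = ennreal (P * exp (w \<bullet> T w / 2)) * ennreal (1 / sqrt (1 - t * \<mu> e))"
    using insert.prems by (subst nn_integral_cmult) (simp_all add: nn_integral_std_normal_exp_square)
  also have "\<dots> = ennreal ((\<Prod>e\<in>insert e E. 1 / sqrt (1 - t * \<mu> e)) * exp (w \<bullet> T w / 2))"
    using insert.hyps P by (simp add: ennreal_mult''[symmetric] P_def[symmetric] mult_ac)
  finally show ?case .
qed

text \<open>This turns the product over the eigenvalues in the previous bound into a function of the trace
  and the largest eigenvalue only.\<close>

lemma inverse_sqrt_le_exp:
  fixes c :: real
  assumes "c < 1"
  shows "1 / sqrt (1 - c) \<le> exp (c / (2 * (1 - c)))"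
proof -
  have "1 / (1 - c) = 1 + c / (1 - c)" using assms by (simp add: field_simps)
  also have "\<dots> \<le> exp (c / (1 - c))" by (rule exp_ge_add_one_self)
  finally have "sqrt (1 / (1 - c)) \<le> sqrt (exp (c / (1 - c)))" by simp
  also have "exp (c / (1 - c)) = (exp (c / (2 * (1 - c))))\<^sup>2"
    using assms by (simp add: field_simps flip: exp_double)
  finally show ?thesis by (simp add: real_sqrt_divide)
qed

theorem subgaussian_norm_mgf:
  fixes \<xi> :: "'w \<Rightarrow> 'v::euclidean_space"
  assumes M: "prob_space M" and meas: "\<xi> \<in> borel_measurable M"
    and T: "pos_semidef T"
    and mgf: "\<And>w. (\<integral>\<^sup>+\<omega>. ennreal (exp (w \<bullet> \<xi> \<omega>)) \<partial>M) \<le> ennreal (exp (w \<bullet> T w / 2))"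
    and t: "0 \<le> t" "t * lambda_max T < 1"
  shows "(\<integral>\<^sup>+\<omega>. ennreal (exp (t / 2 * (norm (\<xi> \<omega>))\<^sup>2)) \<partial>M)
    \<le> ennreal (exp (t * op_trace T / (2 * (1 - t * lambda_max T))))"
proof -
  obtain E \<mu> where E: "orthonormal E" "span E = UNIV" "\<And>e. e \<in> E \<Longrightarrow> T e = \<mu> e *\<^sub>R e"
    "finite E" "\<And>e. e \<in> E \<Longrightarrow> 0 \<le> \<mu> e" "\<And>e. e \<in> E \<Longrightarrow> \<mu> e \<le> lambda_max T"
    "op_trace T = sum \<mu> E"
    using pos_semidef_eigenbasis[OF T] by metis
  have lin: "linear T" using T by (simp add: pos_semidef_def self_adjoint_def)
  have norm: "(norm v)\<^sup>2 = (\<Sum>e\<in>E. (e \<bullet> v)\<^sup>2)" for v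
  proof -
    have "v \<bullet> v = (\<Sum>e\<in>E. (e \<bullet> v) *\<^sub>R e) \<bullet> v"
      by (simp only: orthonormal_expansion[OF E(1,2)])
    then show ?thesis
      unfolding power2_norm_eq_inner by (simp add: inner_sum_left power2_eq_square)
  qed
  have small: "t * \<mu> e < 1" "t * \<mu> e \<le> t * lambda_max T" if "e \<in> E" for e
    using mult_left_mono[OF E(6)[OF that] t(1)] t(2) by auto
  have "(\<integral>\<^sup>+\<omega>. ennreal (exp (t / 2 * (norm (\<xi> \<omega>))\<^sup>2)) \<partial>M)
      \<le> ennreal (\<Prod>e\<in>E. 1 / sqrt (1 - t * \<mu> e))"
    using subgaussian_exp_quadratic[OF M meas lin mgf E(4,1,3) t(1) small(1), where w = 0]
    by (simp add: norm linear_0[OF lin])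
  also have "(\<Prod>e\<in>E. 1 / sqrt (1 - t * \<mu> e)) \<le> (\<Prod>e\<in>E. exp (t * \<mu> e / (2 * (1 - t * lambda_max T))))"
  proof (intro prod_mono conjI)
    fix e assume e: "e \<in> E"
    show "0 \<le> 1 / sqrt (1 - t * \<mu> e)" using small[OF e] by simp
    have "1 / sqrt (1 - t * \<mu> e) \<le> exp (t * \<mu> e / (2 * (1 - t * \<mu> e)))"
      using small[OF e] by (intro inverse_sqrt_le_exp)
    also have "\<dots> \<le> exp (t * \<mu> e / (2 * (1 - t * lambda_max T)))"
      using small[OF e] t E(5)[OF e] by (intro iffD2[OF exp_le_cancel_iff] divide_left_mono) auto
    finally show "1 / sqrt (1 - t * \<mu> e) \<le> exp (t * \<mu> e / (2 * (1 - t * lambda_max T)))" .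
  qed
  also have "\<dots> = exp (t * op_trace T / (2 * (1 - t * lambda_max T)))"
    by (simp add: E(4,7) exp_sum[symmetric] sum_distrib_left sum_divide_distrib)
  finally show ?thesis by (simp add: ennreal_leI)
qed

text \<open>Chernoff bound for the squared norm of a sub-Gaussian vector (Hsu, Kakade and Zhang). The
  quantile comes out with exact constants since the exponent
  \<open>t z\<^sup>2 / 2 - t p / (2 (1 - t l))\<close>, where \<open>p\<close> is the trace and \<open>l\<close> the largest eigenvalue, equals
  \<open>x\<close> for \<open>z = sqrt p + sqrt (2 l x)\<close> and a suitable \<open>t\<close>, provided \<open>l > 0\<close>.\<close>

theorem subgaussian_norm_deviation:
  fixes \<xi> :: "'w \<Rightarrow> 'v::euclidean_space"
  assumes M: "prob_space M" and meas: "\<xi> \<in> borel_measurable M"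
    and T: "pos_semidef T"
    and mgf: "\<And>w. (\<integral>\<^sup>+\<omega>. ennreal (exp (w \<bullet> \<xi> \<omega>)) \<partial>M) \<le> ennreal (exp (w \<bullet> T w / 2))"
    and x: "0 \<le> x"
  shows "1 - exp (- x) \<le> measure M {\<omega> \<in> space M. norm (\<xi> \<omega>) \<le> zq T x}"
proof -
  interpret prob_space M by fact
  note [measurable] = meas
  define l where "l = lambda_max T"
  define p where "p = op_trace T"
  define z where "z = zq T x"
  obtain E \<mu> where E: "\<And>e. e \<in> E \<Longrightarrow> T e = \<mu> e *\<^sub>R e"
    "finite E" "\<And>e. e \<in> E \<Longrightarrow> 0 \<le> \<mu> e" "\<And>e. e \<in> E \<Longrightarrow> \<mu> e \<le> l"
    "p = sum \<mu> E" "l \<in> \<mu> ` E"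
    using pos_semidef_eigenbasis[OF T] unfolding l_def p_def by metis
  have "0 \<le> l" using E by auto
  have p: "0 \<le> p" using E by (simp add: sum_nonneg)
  have z: "z = sqrt p + sqrt (2 * l * x)" by (simp add: z_def zq_def p_def l_def)
  have "0 \<le> z" using p \<open>0 \<le> l\<close> x by (simp add: z)
  have bound: "(\<integral>\<^sup>+\<omega>. ennreal (exp (t / 2 * (norm (\<xi> \<omega>))\<^sup>2)) \<partial>M) \<le> ennreal (exp (t * p / (2 * (1 - t * l))))"
    if "0 \<le> t" "t * l < 1" for t
    using subgaussian_norm_mgf[OF M meas T mgf] that unfolding l_def p_def by simp
  have "prob {\<omega> \<in> space M. z < norm (\<xi> \<omega>)} \<le> exp (- x)"
  proof (cases "l = 0")
    case True
    \<comment> \<open>Here \<open>T = 0\<close> and \<open>\<xi>\<close> vanishes almost surely.\<close>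
    have "p = 0" using E True by (metis antisym sum.neutral)
    have "1 + (\<integral>\<^sup>+\<omega>. ennreal ((norm (\<xi> \<omega>))\<^sup>2) \<partial>M) = (\<integral>\<^sup>+\<omega>. ennreal (1 + (norm (\<xi> \<omega>))\<^sup>2) \<partial>M)"
      by (simp add: ennreal_plus nn_integral_add emeasure_space_1 del: ennreal_plus[symmetric])
    also have "\<dots> \<le> (\<integral>\<^sup>+\<omega>. ennreal (exp ((norm (\<xi> \<omega>))\<^sup>2)) \<partial>M)"
      by (intro nn_integral_mono ennreal_leI) (rule exp_ge_add_one_self)
    also have "\<dots> \<le> 1" using bound[of 2] True \<open>p = 0\<close> by simp
    finally have "(\<integral>\<^sup>+\<omega>. ennreal ((norm (\<xi> \<omega>))\<^sup>2) \<partial>M) = 0"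
      by (metis add.right_neutral ennreal_add_left_cancel_le ennreal_one_neq_top infinity_ennreal_def le_zero_eq)
    then have "AE \<omega> in M. \<xi> \<omega> = 0" by (simp add: nn_integral_0_iff_AE)
    then have "prob {\<omega> \<in> space M. z < norm (\<xi> \<omega>)} = 0"
      using \<open>0 \<le> z\<close> by (intro prob_eq_0[THEN iffD2]) (auto elim!: eventually_mono)
    then show ?thesis by simp
  next
    case False
    then have l: "0 < l" using \<open>0 \<le> l\<close> by simp
    show ?thesis
    proof (cases "x = 0")
      case False
      then have x: "0 < x" using x by simp
      have "p \<noteq> 0"
      proof
        assume "p = 0"
        then have "\<forall>e\<in>E. \<mu> e = 0" using E by (simp add: sum_nonneg_eq_0_iff)
        then show False using E(6) \<open>l \<noteq> 0\<close> by auto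
      qed
      then have "0 < p" using p by simp
      define r where "r = sqrt (2 * l * x)"
      have r: "0 < r" "r\<^sup>2 = 2 * l * x" using l x by (simp_all add: r_def)
      \<comment> \<open>The Chernoff exponent \<open>t z\<^sup>2 / 2 - t p / (2 (1 - t l))\<close> is largest here, with value \<open>x\<close>.\<close>
      define t where "t = r / (z * l)"
      have zp: "z = sqrt p + r" by (simp add: z r_def)
      have "0 < z" using r p by (simp add: zp add_nonneg_pos)
      have tl: "t * l = r / z" using l by (simp add: t_def)
      have t: "0 < t" "t * l < 1"
        using r l \<open>0 < z\<close> \<open>0 < p\<close> by (simp_all add: t_def zp)
      have "1 - t * l = sqrt p / z"
        using \<open>0 < z\<close> unfolding tl by (simp add: field_simps zp)
      then have "p / (1 - t * l) = p / sqrt p * z" by simp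
      also have "\<dots> = sqrt p * z" using p by (simp only: real_div_sqrt)
      finally have expo: "t * p / (2 * (1 - t * l)) = t / 2 * (sqrt p * z)"
        by (metis times_divide_times_eq)
      have "t / 2 * z\<^sup>2 - t / 2 * (sqrt p * z) = t * z / 2 * (z - sqrt p)"
        by (simp add: algebra_simps power2_eq_square)
      also have "\<dots> = r\<^sup>2 / (2 * l)"
        using l \<open>0 < z\<close> by (simp add: t_def zp power2_eq_square)
      also have "\<dots> = x" using l by (simp add: r)
      finally have val: "t / 2 * (sqrt p * z) = t / 2 * z\<^sup>2 - x" by simp
      have "emeasure M {\<omega> \<in> space M. 1 \<le> ennreal (exp (- (t / 2 * z\<^sup>2))) * ennreal (exp (t / 2 * (norm (\<xi> \<omega>))\<^sup>2))}
          \<le> ennreal (exp (- (t / 2 * z\<^sup>2))) * (\<integral>\<^sup>+\<omega>. ennreal (exp (t / 2 * (norm (\<xi> \<omega>))\<^sup>2)) * indicator (space M) \<omega> \<partial>M)"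
        by (intro nn_integral_Markov_inequality) auto
      also have "(\<integral>\<^sup>+\<omega>. ennreal (exp (t / 2 * (norm (\<xi> \<omega>))\<^sup>2)) * indicator (space M) \<omega> \<partial>M)
          = (\<integral>\<^sup>+\<omega>. ennreal (exp (t / 2 * (norm (\<xi> \<omega>))\<^sup>2)) \<partial>M)"
        by (intro nn_integral_cong) simp
      also have "ennreal (exp (- (t / 2 * z\<^sup>2))) * \<dots> \<le> ennreal (exp (- (t / 2 * z\<^sup>2))) * ennreal (exp (t * p / (2 * (1 - t * l))))"
        using t by (intro mult_left_mono bound) auto
      also have "\<dots> = ennreal (exp (- x))"
        unfolding expo val by (simp add: ennreal_mult[symmetric] exp_add[symmetric])
      finally have "emeasure M {\<omega> \<in> space M. 1 \<le> ennreal (exp (- (t / 2 * z\<^sup>2))) * ennreal (exp (t / 2 * (norm (\<xi> \<omega>))\<^sup>2))}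
          \<le> ennreal (exp (- x))" .
      moreover have "{\<omega> \<in> space M. z < norm (\<xi> \<omega>)} \<subseteq>
          {\<omega> \<in> space M. 1 \<le> ennreal (exp (- (t / 2 * z\<^sup>2))) * ennreal (exp (t / 2 * (norm (\<xi> \<omega>))\<^sup>2))}"
      proof clarify
        fix \<omega> assume "z < norm (\<xi> \<omega>)"
        then have "z\<^sup>2 \<le> (norm (\<xi> \<omega>))\<^sup>2" using \<open>0 \<le> z\<close> by (intro power_mono) auto
        then have "1 \<le> exp (t / 2 * ((norm (\<xi> \<omega>))\<^sup>2 - z\<^sup>2))" using t by simp
        then show "1 \<le> ennreal (exp (- (t / 2 * z\<^sup>2))) * ennreal (exp (t / 2 * (norm (\<xi> \<omega>))\<^sup>2))"
          by (simp add: ennreal_mult[symmetric] exp_add[symmetric] algebra_simps ennreal_ge_1)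
      qed
      ultimately have "emeasure M {\<omega> \<in> space M. z < norm (\<xi> \<omega>)} \<le> ennreal (exp (- x))"
        by (rule order_trans[OF emeasure_mono, rotated 2]) measurable
      then show ?thesis by (simp add: emeasure_eq_measure)
    qed simp
  qed
  moreover have "prob {\<omega> \<in> space M. norm (\<xi> \<omega>) \<le> z} = 1 - prob {\<omega> \<in> space M. z < norm (\<xi> \<omega>)}"
    by (subst prob_neg[symmetric]) (auto simp: not_less)
  ultimately show ?thesis by (simp add: z_def)
qed

section \<open>Directional derivatives of smooth functions\<close>

text \<open>The direction comes first and the result is again a function of the base point, so that the
  operator can be iterated with \<open>^^\<close>.\<close>

definition dirder ::
  "'v::euclidean_space \<Rightarrow> ('v \<Rightarrow> 'w::euclidean_space) \<Rightarrow> 'v \<Rightarrow> 'w" where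
  "dirder v F = (\<lambda>x. frechet_derivative F (at x) v)"

declare C_k.simps(2) [simp del]

lemma C_k_Suc: "C_k (Suc k) F \<longleftrightarrow> (\<forall>x. F differentiable (at x)) \<and> (\<forall>v. C_k k (dirder v F))"
  by (simp add: C_k.simps(2) dirder_def)

lemma C_k_differentiable: "C_k (Suc k) F \<Longrightarrow> F differentiable (at x)"
  by (simp add: C_k_Suc)

lemma C_k_dirder: "C_k (Suc k) F \<Longrightarrow> C_k k (dirder v F)"
  by (simp add: C_k_Suc)

lemma dirder_eq: "(F has_derivative F') (at x) \<Longrightarrow> dirder v F x = F' v"
  by (simp add: dirder_def frechet_derivative_at[symmetric])

lemma C_k_has_derivative: "C_k (Suc k) F \<Longrightarrow> (F has_derivative (\<lambda>v. dirder v F x)) (at x)"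
  by (simp add: dirder_def frechet_derivative_works[symmetric] C_k_differentiable)

lemma C_k_continuous: "C_k k F \<Longrightarrow> continuous_on UNIV F"
  by (cases k) (auto simp: C_k_Suc intro: differentiable_imp_continuous_on differentiable_on_def
      simp: differentiable_on_def)

lemma C_k_SucD: "C_k (Suc k) F \<Longrightarrow> C_k k F"
proof (induction k arbitrary: F)
  case 0
  then show ?case using C_k_continuous by simp
next
  case (Suc k)
  then show ?case using C_k_Suc by blast
qed

lemma C_k_SucI:
  assumes "\<And>x. (F has_derivative F' x) (at x)" "\<And>v. C_k k (\<lambda>x. F' x v)"
  shows "C_k (Suc k) F"
proof -
  have "dirder v F = (\<lambda>x. F' x v)" for v using assms(1) dirder_eq by blast
  then show ?thesis using assms by (auto simp: C_k_Suc differentiable_def)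
qed

lemma C_k_const: "C_k k (\<lambda>x. c)"
proof (induction k arbitrary: c)
  case (Suc k)
  show ?case by (rule C_k_SucI[where F' = "\<lambda>_ _. 0"]) (auto intro: Suc)
qed simp

lemma C_k_linear: "linear L \<Longrightarrow> C_k k L"
proof (cases k)
  case (Suc m)
  assume "linear L"
  then show ?thesis unfolding Suc
    by (intro C_k_SucI[where F' = "\<lambda>_. L"] C_k_const)
      (simp add: linear_imp_has_derivative)
qed (simp add: linear_continuous_on linear_conv_bounded_linear)

lemma C_k_add: "C_k k F \<Longrightarrow> C_k k H \<Longrightarrow> C_k k (\<lambda>x. F x + H x)"
proof (induction k arbitrary: F H)
  case (Suc k)
  show ?case
    by (rule C_k_SucI[where F' = "\<lambda>x v. dirder v F x + dirder v H x"])
      (use Suc in \<open>auto intro!: has_derivative_add C_k_has_derivative Suc.IH C_k_dirder\<close>)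
qed (simp add: continuous_on_add)

lemma C_k_scaleR: "C_k k F \<Longrightarrow> C_k k (\<lambda>x. c *\<^sub>R F x)"
proof (induction k arbitrary: F)
  case (Suc k)
  show ?case
    by (rule C_k_SucI[where F' = "\<lambda>x v. c *\<^sub>R dirder v F x"])
      (use Suc in \<open>auto intro!: has_derivative_scaleR_right C_k_has_derivative Suc.IH C_k_dirder\<close>)
qed (simp add: continuous_on_scaleR)

lemma C_k_diff: "C_k k F \<Longrightarrow> C_k k H \<Longrightarrow> C_k k (\<lambda>x. F x - H x)"
  using C_k_add[of k F "\<lambda>x. - 1 *\<^sub>R H x"] C_k_scaleR[of k H "- 1"] by simp

lemma C_k_inner: "C_k k F \<Longrightarrow> C_k k H \<Longrightarrow> C_k k (\<lambda>x. F x \<bullet> H x)"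
proof (induction k arbitrary: F H)
  case (Suc k)
  show ?case
    by (rule C_k_SucI[where F' = "\<lambda>x v. F x \<bullet> dirder v H x + dirder v F x \<bullet> H x"])
      (use Suc in \<open>auto intro!: has_derivative_inner C_k_has_derivative C_k_add Suc.IH
        intro: C_k_dirder C_k_SucD\<close>)
qed (simp add: continuous_on_inner)

lemma C_k_compose_linear:
  assumes L: "linear L"
  shows "C_k k F \<Longrightarrow> C_k k (\<lambda>x. F (L x))"
proof (induction k arbitrary: F)
  case 0
  then show ?case
    using L continuous_on_compose2[of UNIV F UNIV L]
    by (simp add: linear_continuous_on linear_conv_bounded_linear)
next
  case (Suc k)
  show ?case
    by (rule C_k_SucI[where F' = "\<lambda>x v. dirder (L v) F (L x)"])
      (use Suc in \<open>auto intro!: has_derivative_compose[OF linear_imp_has_derivative[OF L]]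
        C_k_has_derivative Suc.IH C_k_dirder\<close>)
qed

lemma C_k_norm_square: "C_k k F \<Longrightarrow> C_k k (\<lambda>x. (norm (F x))\<^sup>2)"
  unfolding power2_norm_eq_inner by (intro C_k_inner)

lemma dirder_sum:
  assumes "\<And>i. i \<in> I \<Longrightarrow> C_k (Suc k) (F i)"
  shows "dirder v (\<lambda>x. \<Sum>i\<in>I. c i *\<^sub>R F i x) = (\<lambda>x. \<Sum>i\<in>I. c i *\<^sub>R dirder v (F i) x)"
  by (rule ext, rule dirder_eq)
    (intro has_derivative_sum has_derivative_scaleR_right C_k_has_derivative[where k = k] assms)

text \<open>Linearity in the direction reduces all directional derivatives to those along basis vectors.\<close>

lemma dirder_direction_expansion:
  assumes "C_k (Suc k) F"
  shows "dirder v F = (\<lambda>x. \<Sum>b\<in>Basis. (v \<bullet> b) *\<^sub>R dirder b F x)"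
proof
  fix x
  have lin: "linear (\<lambda>v. dirder v F x)"
    using C_k_has_derivative[OF assms] has_derivative_linear by blast
  have "dirder v F x = dirder (\<Sum>b\<in>Basis. (v \<bullet> b) *\<^sub>R b) F x"
    by (simp only: euclidean_representation)
  then show "dirder v F x = (\<Sum>b\<in>Basis. (v \<bullet> b) *\<^sub>R dirder b F x)"
    by (simp only: linear_sum[OF lin] linear_cmul[OF lin])
qed

lemma C_k_funpow_dirder: "C_k (m + k) F \<Longrightarrow> C_k k ((dirder v ^^ m) F)"
  by (induction m arbitrary: k) (auto intro: C_k_dirder)

lemma funpow_dirder_sum:
  assumes "\<And>i. i \<in> I \<Longrightarrow> C_k k (F i)"
  shows "(dirder v ^^ k) (\<lambda>x. \<Sum>i\<in>I. c i *\<^sub>R F i x) = (\<lambda>x. \<Sum>i\<in>I. c i *\<^sub>R (dirder v ^^ k) (F i) x)"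
  using assms
proof (induction k)
  case (Suc k)
  have "C_k (Suc 0) ((dirder v ^^ k) (F i))" if "i \<in> I" for i
    using Suc.prems[OF that] by (intro C_k_funpow_dirder) simp
  moreover have "(dirder v ^^ k) (\<lambda>x. \<Sum>i\<in>I. c i *\<^sub>R F i x) = (\<lambda>x. \<Sum>i\<in>I. c i *\<^sub>R (dirder v ^^ k) (F i) x)"
    using Suc.IH Suc.prems C_k_SucD by blast
  ultimately show ?case by (simp add: dirder_sum[where k = 0])
qed simp

lemma has_vector_derivative_along_line:
  assumes "C_k (Suc k) F"
  shows "((\<lambda>t. F (x + t *\<^sub>R u)) has_vector_derivative dirder u F (x + t *\<^sub>R u)) (at t)"
proof -
  have "((\<lambda>t. F (x + t *\<^sub>R u)) has_derivative (\<lambda>s. dirder (s *\<^sub>R u) F (x + t *\<^sub>R u))) (at t)"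
    by (rule has_derivative_compose[OF _ C_k_has_derivative[OF assms]])
      (auto intro!: derivative_eq_intros)
  then show ?thesis
    using linear_cmul[OF has_derivative_linear[OF C_k_has_derivative[OF assms]]]
    by (simp add: has_vector_derivative_def)
qed

text \<open>The bridge between the two descriptions of higher derivatives: iterated one-variable derivatives
  along a line are iterated directional derivatives.\<close>

lemma iter_deriv_along_line:
  "C_k k F \<Longrightarrow> iter_deriv k (\<lambda>t. F (x + t *\<^sub>R u)) = (\<lambda>t. (dirder u ^^ k) F (x + t *\<^sub>R u))"
proof (induction k arbitrary: F)
  case 0
  show ?case by (simp add: iter_deriv_def)
next
  case (Suc k)
  note has_vector_derivative_along_line[OF Suc.prems, of x u]
  then have "(\<lambda>t. vector_derivative (\<lambda>t. F (x + t *\<^sub>R u)) (at t)) = (\<lambda>t. dirder u F (x + t *\<^sub>R u))"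
    by (intro ext vector_derivative_at)
  then show ?case
    using Suc.IH[OF C_k_dirder[OF Suc.prems, of u]]
    by (simp add: iter_deriv_def funpow_Suc_right del: funpow.simps)
qed

lemma dir_deriv_eq_funpow_dirder: "C_k m F \<Longrightarrow> dir_deriv m F x u = (dirder u ^^ m) F x"
  by (simp add: dir_deriv_def iter_deriv_along_line)

text \<open>A \<open>k\<close>-th directional derivative is a homogeneous form of degree \<open>k\<close> in the direction, with
  coefficients that are continuous in the base point. The bound is uniform in both arguments; it
  keeps the suprema in \<^const>\<open>delta3\<close> finite.\<close>

lemma funpow_dirder_bounded_on_compact:
  assumes K: "compact K" and F: "C_k k F"
  shows "\<exists>c\<ge>0. \<forall>x\<in>K. \<forall>u. norm ((dirder u ^^ k) F x) \<le> c * norm u ^ k"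
  using F
proof (induction k arbitrary: F)
  case 0
  then have "compact (F ` K)"
    using K by (intro compact_continuous_image) (auto intro: continuous_on_subset)
  then obtain c where "\<forall>y\<in>F ` K. norm y \<le> c" using compact_imp_bounded bounded_iff by blast
  then show ?case by (intro exI[of _ "max c 0"]) force
next
  case (Suc k)
  have "\<exists>c\<ge>0. \<forall>x\<in>K. \<forall>u. norm ((dirder u ^^ k) (dirder b F) x) \<le> c * norm u ^ k" for b
    using Suc.IH C_k_dirder[OF Suc.prems] by blast
  then obtain c where c: "\<And>b. 0 \<le> c b"
    "\<And>b x u. x \<in> K \<Longrightarrow> norm ((dirder u ^^ k) (dirder b F) x) \<le> c b * norm u ^ k"
    by metis
  show ?case
  proof (intro exI[of _ "sum c Basis"] conjI ballI allI)
    show "0 \<le> sum c Basis" using c(1) by (simp add: sum_nonneg)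
    fix x u assume x: "x \<in> K"
    have "(dirder u ^^ Suc k) F x = (dirder u ^^ k) (dirder u F) x"
      by (simp add: funpow_Suc_right del: funpow.simps)
    also have "\<dots> = (\<Sum>b\<in>Basis. (u \<bullet> b) *\<^sub>R (dirder u ^^ k) (dirder b F) x)"
      unfolding dirder_direction_expansion[OF Suc.prems, of u]
      by (subst funpow_dirder_sum) (simp_all add: C_k_dirder[OF Suc.prems])
    also have "norm \<dots> \<le> (\<Sum>b\<in>Basis. norm u * (c b * norm u ^ k))"
      using c x by (intro sum_norm_le) (auto intro!: mult_mono Basis_le_norm)
    finally show "norm ((dirder u ^^ Suc k) F x) \<le> sum c Basis * norm u ^ Suc k"
      by (simp add: sum_distrib_right sum_distrib_left mult_ac)
  qed
qed

lemma gradient_eq_sum_dirder: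
  assumes "C_k (Suc k) F"
  shows "gradient F = (\<lambda>x. \<Sum>b\<in>Basis. dirder b F x *\<^sub>R b)"
proof
  fix x
  let ?g = "\<Sum>b\<in>Basis. dirder b F x *\<^sub>R b"
  have inner: "?g \<bullet> v = dirder v F x" for v
    unfolding dirder_direction_expansion[OF assms, of v]
    by (simp add: inner_sum_left inner_commute[of v] mult.commute)
  have g: "GDERIV F x :> ?g"
    using C_k_has_derivative[OF assms, of x] by (simp add: gderiv_def inner inner_commute[of _ ?g])
  show "gradient F x = ?g"
    unfolding gradient_def
  proof (rule the_equality)
    show "GDERIV F x :> ?g" by (rule g)
  next
    fix D assume "GDERIV F x :> D"
    then have "dirder v F x = v \<bullet> D" for v
      unfolding gderiv_def by (rule dirder_eq)
    then have "D \<bullet> v = ?g \<bullet> v" for v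
      unfolding inner by (simp add: inner_commute)
    then show "D = ?g" using vector_eq_rdot by blast
  qed
qed

text \<open>Expanding the inner direction in the basis turns the iterated directional derivative into the
  components of the derivative of the gradient.\<close>

lemma inner_hessian:
  assumes F: "C_k (Suc (Suc k)) F"
  shows "u \<bullet> hessian F x u = dirder u (dirder u F) x"
proof -
  have "((\<lambda>x. \<Sum>b\<in>Basis. dirder b F x *\<^sub>R b) has_derivative
      (\<lambda>v. \<Sum>b\<in>Basis. dirder v (dirder b F) x *\<^sub>R b)) (at x)"
    by (intro has_derivative_sum has_derivative_scaleR_left C_k_has_derivative[where k = k] C_k_dirder[OF F])
  then have "hessian F x u = (\<Sum>b\<in>Basis. dirder u (dirder b F) x *\<^sub>R b)"
    unfolding hessian_def gradient_eq_sum_dirder[OF F] by (simp add: frechet_derivative_at[symmetric])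
  then have "u \<bullet> hessian F x u = (\<Sum>b\<in>Basis. (u \<bullet> b) *\<^sub>R dirder u (dirder b F) x)"
    by (simp add: inner_sum_right mult.commute)
  also have "\<dots> = dirder u (dirder u F) x"
    unfolding dirder_direction_expansion[OF F, of u]
    by (subst dirder_sum[where k = k]) (simp_all add: C_k_dirder[OF F])
  finally show ?thesis .
qed

lemma funpow_dirder_combination:
  assumes "C_k k F" "C_k k H"
  shows "(dirder v ^^ k) (\<lambda>x. c *\<^sub>R F x + d *\<^sub>R H x)
    = (\<lambda>x. c *\<^sub>R (dirder v ^^ k) F x + d *\<^sub>R (dirder v ^^ k) H x)"
  using assms
proof (induction k)
  case (Suc k)
  have FH: "C_k (Suc 0) ((dirder v ^^ k) F)" "C_k (Suc 0) ((dirder v ^^ k) H)"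
    using Suc.prems by (auto intro!: C_k_funpow_dirder)
  have "(dirder v ^^ k) (\<lambda>x. c *\<^sub>R F x + d *\<^sub>R H x)
      = (\<lambda>x. c *\<^sub>R (dirder v ^^ k) F x + d *\<^sub>R (dirder v ^^ k) H x)"
    using Suc C_k_SucD by blast
  moreover have "dirder v (\<lambda>x. c *\<^sub>R (dirder v ^^ k) F x + d *\<^sub>R (dirder v ^^ k) H x)
      = (\<lambda>x. c *\<^sub>R dirder v ((dirder v ^^ k) F) x + d *\<^sub>R dirder v ((dirder v ^^ k) H) x)"
    by (rule ext, rule dirder_eq)
      (intro has_derivative_add has_derivative_scaleR_right C_k_has_derivative[OF FH(1)]
        C_k_has_derivative[OF FH(2)])
  ultimately show ?case by simp
qed simp

text \<open>Quadratic terms of a criterion do not contribute to its third derivatives.\<close>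

lemma third_dirder_norm_square_affine:
  fixes L :: "'v::euclidean_space \<Rightarrow> 'w::euclidean_space"
  assumes L: "linear L"
  shows "(dirder v ^^ 3) (\<lambda>x. (norm (L x + c))\<^sup>2 + k) = (\<lambda>x. 0)"
proof -
  note [derivative_intros] = linear_imp_has_derivative[OF L]
  have "dirder v (\<lambda>x. (norm (L x + c))\<^sup>2 + k) = (\<lambda>x. 2 * ((L x + c) \<bullet> L v))"
    unfolding power2_norm_eq_inner
    by (rule ext, rule dirder_eq) (auto intro!: derivative_eq_intros simp: inner_commute)
  moreover have "dirder v (\<lambda>x. 2 * ((L x + c) \<bullet> L v)) = (\<lambda>x. 2 * (L v \<bullet> L v))"
    by (rule ext, rule dirder_eq) (auto intro!: derivative_eq_intros)
  moreover have "dirder v (\<lambda>x. 2 * (L v \<bullet> L v)) = (\<lambda>x. 0)"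
    by (rule ext, rule dirder_eq) (auto intro!: derivative_eq_intros)
  ultimately show ?thesis by (simp add: eval_nat_numeral)
qed

section \<open>Maximiser of a linearly tilted concave function\<close>

lemma funpow_dirder_has_real_derivative_along_line:
  fixes f :: "'v::euclidean_space \<Rightarrow> real"
  assumes "C_k 3 f" "m < 3"
  shows "((\<lambda>t. (dirder u ^^ m) f (x + t *\<^sub>R u)) has_real_derivative (dirder u ^^ Suc m) f (x + t *\<^sub>R u)) (at t)"
proof -
  have "C_k (Suc (2 - m)) ((dirder u ^^ m) f)"
    using assms by (intro C_k_funpow_dirder) simp
  from has_vector_derivative_along_line[OF this, of x u t] show ?thesis
    by (simp add: has_real_derivative_iff_has_vector_derivative)
qed

text \<open>An injective linear map of a finite-dimensional space is bounded below.\<close>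

lemma compact_ellipsoid:
  fixes D :: "'v::euclidean_space \<Rightarrow> 'v"
  assumes D: "linear D" and D_inj: "\<And>u. D u = 0 \<Longrightarrow> u = 0"
  shows "compact {v. norm (D (v - v0)) \<le> r}"
proof -
  obtain B where B: "B > 0" "\<And>u. B * norm u \<le> norm (D u)"
    using linear_inj_bounded_below_pos[OF D] D_inj linear_injective_0[OF D] by metis
  have "closed {v. norm (D (v - v0)) \<le> r}"
    by (intro closed_Collect_le continuous_intros linear_continuous_on_compose[OF _ D])
  moreover have "{v. norm (D (v - v0)) \<le> r} \<subseteq> cball v0 (r / B)"
  proof
    fix v assume "v \<in> {v. norm (D (v - v0)) \<le> r}"
    then have "B * norm (v - v0) \<le> r" using B(2)[of "v - v0"] by simp
    then show "v \<in> cball v0 (r / B)"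
      using B(1) by (simp add: dist_norm norm_minus_commute field_simps)
  qed
  ultimately show ?thesis
    using bounded_subset bounded_cball compact_eq_bounded_closed by blast
qed

text \<open>A concave function \<open>f\<close> with maximum at \<open>v0\<close> is perturbed by the linear functional \<open>a\<close>. Its
  curvature at \<open>v0\<close> is \<open>D\<^sup>2\<close>, and \<open>\<delta>\<close> bounds its third derivatives on the ellipsoid of radius \<open>r\<close>. The
  vector \<open>u0\<close> is the Newton step \<open>D\<^sup>-\<^sup>2 a\<close>, described through \<open>tilt\<close> without inverting \<open>D\<close>; it has to
  stay away from the boundary of the ellipsoid by a margin that absorbs the third-order error.\<close>

locale tilted_concave_maximum =
  fixes f :: "'v::euclidean_space \<Rightarrow> real" and U :: "'v set" and v0 a u0 :: 'v
    and D :: "'v \<Rightarrow> 'v" and r \<rho> \<delta> :: real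
  assumes smooth: "C_k 3 f" and U: "open U" and concave: "concave_on U f"
    and max: "is_arg_max f (\<lambda>v. v \<in> U) v0"
    and D: "linear D" and D_inj: "\<And>u. D u = 0 \<Longrightarrow> u = 0"
    and curvature: "\<And>u. dirder u (dirder u f) v0 = - (norm (D u))\<^sup>2"
    and r: "0 < r" and ball: "{v. norm (D (v - v0)) \<le> r} \<subseteq> U"
    and third: "\<And>v u. norm (D (v - v0)) \<le> r \<Longrightarrow> norm (D u) \<le> r \<Longrightarrow> \<bar>(dirder u ^^ 3) f v\<bar> \<le> \<delta>"
    and \<delta>: "3 * \<delta> / r\<^sup>2 \<le> \<rho>" "\<rho> \<le> 1 / 2"
    and tilt: "\<And>u. a \<bullet> u = D u0 \<bullet> D u" and tilt_small: "norm (D u0) \<le> (1 - \<rho>) * r"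
begin

definition tilted :: "'v \<Rightarrow> real" where "tilted v = f v + a \<bullet> v"

lemma \<delta>_nonneg: "0 \<le> \<delta>"
  using third[of v0 0] r linear_0[OF D] by simp

lemma \<delta>_le: "\<delta> \<le> \<rho> * r\<^sup>2 / 3"
  using \<delta>(1) r by (simp add: field_simps)

lemma \<rho>_nonneg: "0 \<le> \<rho>"
proof -
  have "0 \<le> 3 * \<delta> / r\<^sup>2" using \<delta>_nonneg by simp
  then show ?thesis using \<delta>(1) by (rule order_trans)
qed

lemma u0_le: "norm (D u0) \<le> r"
proof -
  have "(1 - \<rho>) * r \<le> 1 * r" using \<rho>_nonneg r by (intro mult_right_mono) auto
  with tilt_small show ?thesis by simp
qed

lemma v0_U: "v0 \<in> U" and v0_max: "v \<in> U \<Longrightarrow> f v \<le> f v0"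
  using max by (auto simp: is_arg_max_def not_less)

lemma on_ray: "norm (D u) \<le> r \<Longrightarrow> 0 \<le> t \<Longrightarrow> t \<le> 1 \<Longrightarrow> norm (D (v0 + t *\<^sub>R u - v0)) \<le> r"
  using mult_mono[of "\<bar>t\<bar>" 1 "norm (D u)" r] by (simp add: linear_cmul[OF D])

lemmas deriv_ray = funpow_dirder_has_real_derivative_along_line[OF smooth]

text \<open>Fermat's rule along lines; \<open>v0\<close> is an interior point because \<open>U\<close> is open.\<close>

lemma stationary: "dirder u f v0 = 0"
proof -
  let ?\<phi> = "\<lambda>t. f (v0 + t *\<^sub>R u)"
  have "(?\<phi> has_real_derivative dirder u f v0) (at 0)"
    using deriv_ray[of 0 u v0 0] by simp
  moreover have "open ((\<lambda>t. v0 + t *\<^sub>R u) -` U)"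
    by (intro open_vimage U continuous_intros)
  then obtain e where "0 < e" "ball 0 e \<subseteq> (\<lambda>t. v0 + t *\<^sub>R u) -` U"
    unfolding open_contains_ball using v0_U by force
  then have "0 < e \<and> (\<forall>t. \<bar>0 - t\<bar> < e \<longrightarrow> ?\<phi> t \<le> ?\<phi> 0)"
    by (auto intro!: v0_max simp: subset_iff dist_real_def)
  ultimately show ?thesis by (metis DERIV_local_max)
qed

lemma third_ray:
  assumes "norm (D u) \<le> r" "0 < t" "t < 1"
  shows "\<bar>(dirder u ^^ 3) f (v0 + t *\<^sub>R u)\<bar> \<le> \<delta>"
  using assms on_ray[of u t] by (intro third) auto

text \<open>Taylor expansion of third order along the segment from \<open>v0\<close>, whose first-order term vanishes.\<close>

lemma quadratic_approximation:
  assumes u: "norm (D u) \<le> r"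
  shows "\<bar>f (v0 + u) - (f v0 - (norm (D u))\<^sup>2 / 2)\<bar> \<le> \<delta> / 6"
proof -
  let ?d = "\<lambda>m t. (dirder u ^^ m) f (v0 + t *\<^sub>R u)"
  obtain t where t: "0 < t" "t < 1" "f (v0 + 1 *\<^sub>R u)
      = (\<Sum>m<3. ?d m 0 / fact m * 1 ^ m) + ?d 3 t / fact 3 * 1 ^ 3"
    using Maclaurin[of 1 3 ?d "\<lambda>t. f (v0 + t *\<^sub>R u)"] deriv_ray[of _ u v0] by auto
  then have "f (v0 + u) - (f v0 - (norm (D u))\<^sup>2 / 2) = ?d 3 t / 6"
    by (simp add: eval_nat_numeral stationary curvature)
  then show ?thesis using third_ray[OF u t(1,2)] by linarith
qed

text \<open>On the boundary of the ellipsoid the quadratic part of \<open>f\<close> pulls back with slope \<open>- r\<^sup>2\<close>, the tilt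
  pushes out with slope at most \<open>(1 - \<rho>) r\<^sup>2\<close>, and the third-order error in the slope is at most
  \<open>\<delta> / 2 \<le> \<rho> r\<^sup>2 / 6\<close>. For \<open>\<rho> = 0\<close> the slope may vanish; the strictly negative second derivative
  is what still separates the boundary from the exterior.\<close>

lemma boundary_derivatives:
  assumes u: "norm (D u) = r"
  shows "dirder u f (v0 + u) + a \<bullet> u \<le> 0" "dirder u (dirder u f) (v0 + u) < 0"
proof -
  let ?d = "\<lambda>m t. (dirder u ^^ m) f (v0 + t *\<^sub>R u)"
  have pos: "0 \<le> \<rho> * r\<^sup>2" "\<rho> * r\<^sup>2 \<le> 1 / 2 * r\<^sup>2" "0 < r\<^sup>2"
    using \<rho>_nonneg \<delta>(2) r by (auto intro: mult_right_mono)
  obtain t where t: "0 < t" "t < 1" "?d (Suc 0) 1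
      = (\<Sum>m<2. ?d (Suc m) 0 / fact m * 1 ^ m) + ?d (Suc 2) t / fact 2 * 1 ^ 2"
    using Maclaurin[of 1 2 "\<lambda>m. ?d (Suc m)" "?d (Suc 0)"] deriv_ray[of "Suc _" u v0] by auto
  then have "dirder u f (v0 + u) = - r\<^sup>2 + ?d 3 t / 2"
    by (simp add: eval_nat_numeral stationary curvature u)
  moreover have "a \<bullet> u \<le> (1 - \<rho>) * r * r"
    unfolding tilt using norm_cauchy_schwarz[of "D u0" "D u"] mult_right_mono[OF tilt_small less_imp_le[OF r]] u
    by simp
  moreover have "?d 3 t \<le> \<delta>" using third_ray[of u t] t u by simp
  ultimately show "dirder u f (v0 + u) + a \<bullet> u \<le> 0"
    using \<delta>_le pos by (simp add: algebra_simps power2_eq_square)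
  obtain t where t: "0 < t" "t < 1" "?d 2 1 - ?d 2 0 = (1 - 0) * ?d 3 t"
    using MVT2[of 0 1 "?d 2" "?d 3"] deriv_ray[of 2 u v0] by auto
  then have "dirder u (dirder u f) (v0 + u) = - r\<^sup>2 + ?d 3 t"
    by (simp add: numeral_2_eq_2 curvature u)
  moreover have "?d 3 t \<le> \<delta>" using third_ray[of u t] t u by simp
  ultimately show "dirder u (dirder u f) (v0 + u) < 0"
    using \<delta>_le pos by linarith
qed

text \<open>Along a ray leaving the ellipsoid the tilted function decreases strictly just after the boundary,
  by the signs of the two radial derivatives; concavity then keeps it below its boundary value for ever.\<close>

lemma tilted_smaller_outside_ball:
  assumes v: "v \<in> U" "r < norm (D (v - v0))"
  obtains w where "norm (D (w - v0)) = r" "tilted v < tilted w"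
proof -
  define s where "s = norm (D (v - v0)) / r"
  define u where "u = (1 / s) *\<^sub>R (v - v0)"
  have s: "1 < s" using v r by (simp add: s_def)
  have u: "norm (D u) = r" "v = v0 + s *\<^sub>R u"
    using r s v(2) by (simp_all add: u_def linear_cmul[OF D]) (auto simp: s_def)
  let ?g = "\<lambda>t. tilted (v0 + t *\<^sub>R u)"
  let ?g' = "\<lambda>t. dirder u f (v0 + t *\<^sub>R u) + a \<bullet> u"
  have g: "(?g has_real_derivative ?g' t) (at t)" for t
    unfolding tilted_def inner_add_right inner_scaleR_right
    using deriv_ray[of 0 u v0 t] by (auto intro!: derivative_eq_intros)
  have "(?g' has_real_derivative dirder u (dirder u f) (v0 + u)) (at 1)"
    using deriv_ray[of 1 u v0 1] by (auto intro!: derivative_eq_intros)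
  from DERIV_neg_dec_right[OF this boundary_derivatives(2)[OF u(1)]]
  obtain d where d: "0 < d" "\<And>t. 0 < t \<Longrightarrow> t < d \<Longrightarrow> ?g' (1 + t) < ?g' 1" by blast
  define e where "e = min (d / 2) (s - 1)"
  have e: "0 < e" "e < d" "e \<le> s - 1" using d(1) s by (auto simp: e_def)
  obtain t where t: "1 < t" "t < 1 + e" "?g (1 + e) - ?g 1 = (1 + e - 1) * ?g' t"
    using MVT2[of 1 "1 + e" ?g ?g'] g e(1) by auto
  have "?g' t < 0"
    using d(2)[of "t - 1"] t e boundary_derivatives(1)[OF u(1)] by simp
  then have less: "?g (1 + e) < ?g 1" using t e mult_pos_neg[of e "?g' t"] by simp
  have "?g s < ?g 1"
  proof (rule ccontr)
    assume "\<not> ?g s < ?g 1"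
    define \<tau> where "\<tau> = e / (s - 1)"
    have \<tau>: "0 \<le> \<tau>" "\<tau> \<le> 1" "1 + e = (1 - \<tau>) * 1 + \<tau> * s"
    proof -
      have "\<tau> * (s - 1) = e" using s by (simp add: \<tau>_def)
      then show "1 + e = (1 - \<tau>) * 1 + \<tau> * s" by (simp add: algebra_simps)
    qed (use e s in \<open>auto simp: \<tau>_def\<close>)
    have U1: "v0 + u \<in> U" using ball u(1) by auto
    have "concave_on U tilted"
      unfolding tilted_def using concave concave_on_imp_convex[OF concave]
      by (intro concave_on_add) (auto simp: concave_on_iff inner_simps)
    then have "(1 - \<tau>) * tilted (v0 + u) + \<tau> * tilted v \<le> tilted ((1 - \<tau>) *\<^sub>R (v0 + u) + \<tau> *\<^sub>R v)"
      by (rule concave_onD[OF _ \<tau>(1,2) U1 v(1)])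
    also have "(1 - \<tau>) *\<^sub>R (v0 + u) + \<tau> *\<^sub>R v = v0 + (1 + e) *\<^sub>R u"
    proof -
      have "(1 - \<tau>) *\<^sub>R (v0 + u) + \<tau> *\<^sub>R (v0 + s *\<^sub>R u) = v0 + ((1 - \<tau>) * 1 + \<tau> * s) *\<^sub>R u"
        by (simp add: scaleR_left_distrib scaleR_right_distrib scaleR_left_diff_distrib)
      then show ?thesis by (simp only: \<tau>(3)[symmetric] u(2)[symmetric])
    qed
    finally have "(1 - \<tau>) * tilted (v0 + u) + \<tau> * tilted v \<le> ?g (1 + e)" .
    moreover have "\<tau> * tilted (v0 + u) \<le> \<tau> * tilted v"
    proof (rule mult_left_mono[OF _ \<tau>(1)])
      show "tilted (v0 + u) \<le> tilted v"
        using \<open>\<not> ?g s < ?g 1\<close> by (simp only: u(2)[symmetric] scaleR_one not_less)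
    qed
    moreover have "(1 - \<tau>) * tilted (v0 + u) = tilted (v0 + u) - \<tau> * tilted (v0 + u)"
      by (simp add: left_diff_distrib)
    ultimately show False using less by simp
  qed
  then have "tilted v < tilted (v0 + u)" by (simp only: u(2)[symmetric] scaleR_one)
  moreover have "norm (D (v0 + u - v0)) = r" using u(1) by simp
  ultimately show thesis by (rule that[rotated])
qed

text \<open>The maximum over the compact ellipsoid is a maximum over \<open>U\<close>, as values outside are dominated
  by values on the boundary.\<close>

lemma tilted_maximum_exists: "\<exists>v. is_arg_max tilted (\<lambda>v. v \<in> U) v"
proof -
  let ?B = "{v. norm (D (v - v0)) \<le> r}"
  have "v0 \<in> ?B" using r linear_0[OF D] by simp
  moreover have "continuous_on ?B tilted"
    unfolding tilted_def by (intro continuous_intros continuous_on_subset[OF C_k_continuous[OF smooth]]) auto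
  ultimately obtain w where w: "w \<in> ?B" "\<And>v. v \<in> ?B \<Longrightarrow> tilted v \<le> tilted w"
    using continuous_attains_sup[OF compact_ellipsoid[OF D D_inj]] by (metis empty_iff)
  have "tilted v \<le> tilted w" if "v \<in> U" for v
  proof (cases "v \<in> ?B")
    case False
    then obtain y where "y \<in> ?B" "tilted v < tilted y"
      using tilted_smaller_outside_ball[OF \<open>v \<in> U\<close>] by force
    then show ?thesis using w(2)[of y] by simp
  qed (use w in auto)
  then show ?thesis using w(1) ball by (intro exI[of _ w]) (auto simp: is_arg_max_def not_less)
qed

text \<open>The quadratic model \<open>f v0 + a \<bullet> u - |D u|\<^sup>2 / 2\<close> is maximal at the Newton step \<open>u0\<close>, where it exceeds
  its value at \<open>u\<close> by \<open>|D (u - u0)|\<^sup>2 / 2\<close>. The maximiser is at least as good as the Newton step for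
  the tilted function, and the model is accurate up to \<open>\<delta> / 6\<close> at both points, so this excess is
  at most \<open>\<delta> / 3\<close>.\<close>

theorem tilted_maximum_near_newton_step:
  assumes v: "is_arg_max tilted (\<lambda>v. v \<in> U) v"
  shows "(norm (D (v - v0 - u0)))\<^sup>2 \<le> \<delta>"
proof -
  have vU: "v \<in> U" and vmax: "\<And>w. w \<in> U \<Longrightarrow> tilted w \<le> tilted v"
    using v by (auto simp: is_arg_max_def not_less)
  define u where "u = v - v0"
  have u: "norm (D u) \<le> r"
  proof (rule ccontr)
    assume "\<not> ?thesis"
    then obtain w where "norm (D (w - v0)) = r" "tilted v < tilted w"
      using tilted_smaller_outside_ball[OF vU] unfolding u_def by force
    moreover from this have "w \<in> U" using ball by auto
    ultimately show False using vmax by force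
  qed
  have "v0 + u0 \<in> U" using ball u0_le by auto
  from vmax[OF this] have "f (v0 + u0) + a \<bullet> u0 \<le> f (v0 + u) + a \<bullet> u"
    by (simp add: tilted_def u_def inner_simps)
  moreover have "a \<bullet> u0 = (norm (D u0))\<^sup>2"
    unfolding tilt by (simp add: power2_norm_eq_inner)
  ultimately have "(norm (D u0))\<^sup>2 / 2 - D u0 \<bullet> D u + (norm (D u))\<^sup>2 / 2 \<le> \<delta> / 3"
    using quadratic_approximation[OF u] quadratic_approximation[OF u0_le]
    unfolding tilt[of u] by linarith
  moreover have "(norm (D (u - u0)))\<^sup>2 = (norm (D u))\<^sup>2 - 2 * (D u0 \<bullet> D u) + (norm (D u0))\<^sup>2"
    by (simp add: linear_diff[OF D] power2_norm_eq_inner inner_diff inner_commute)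
  ultimately show ?thesis using \<delta>_nonneg unfolding u_def by simp
qed

end

section \<open>Positive definite operators and their blocks\<close>

lemma inv_operator:
  fixes F :: "'v::euclidean_space \<Rightarrow> 'v"
  assumes F: "self_adjoint F" "bij F"
  shows "F (inv F x) = x" "linear (inv F)" "inv F x \<bullet> y = x \<bullet> inv F y"
proof -
  have lin: "linear F" and sym: "\<And>x y. F x \<bullet> y = x \<bullet> F y"
    using F(1) by (auto simp: self_adjoint_def)
  show FI: "F (inv F x) = x" for x using F(2) by (simp add: bij_is_surj surj_f_inv_f)
  show "linear (inv F)"
    by (rule linearI; intro inv_f_eq[OF bij_is_inj[OF F(2)]])
      (simp_all add: linear_add[OF lin] linear_cmul[OF lin] FI)
  show "inv F x \<bullet> y = x \<bullet> inv F y"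
    using sym[of "inv F x" "inv F y"] by (simp add: FI)
qed

lemma is_pos_sqrtD:
  assumes "is_pos_sqrt R T"
  shows "linear R" "self_adjoint T" "T x \<bullet> y = R x \<bullet> R y"
proof -
  have lin: "linear R" and sym: "\<And>x y. R x \<bullet> y = x \<bullet> R y" and T: "\<And>x. R (R x) = T x"
    using assms by (auto simp: is_pos_sqrt_def pos_semidef_def self_adjoint_def fun_eq_iff)
  show "linear R" by (fact lin)
  show prod: "T x \<bullet> y = R x \<bullet> R y" for x y using sym[of "R x" y] by (simp add: T)
  have "linear T" using linear_compose[OF lin lin] assms by (simp add: is_pos_sqrt_def)
  then show "self_adjoint T"
    using prod by (simp add: self_adjoint_def) (metis inner_commute)
qed

lemma bij_pos_sqrt_inj:
  assumes "is_pos_sqrt R T" "bij T" "R x = 0"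
  shows "x = 0"
proof -
  have "T x \<bullet> T x = 0" using is_pos_sqrtD(3)[OF assms(1), of x "T x"] assms(3) by simp
  then have "T x = T 0"
    using is_pos_sqrtD(2)[OF assms(1)] by (simp add: self_adjoint_def linear_0)
  then show ?thesis using bij_is_inj[OF assms(2)] by (simp add: inj_eq)
qed

text \<open>The square root \<open>R\<close> of the \<open>ff\<close>-block of the inverse measures exactly how much the
  projection onto the first component can stretch the norm \<open>|D v|\<close>. By duality one tests with
  \<open>w = Q (fst v)\<close>: the functional \<open>v \<mapsto> p \<bullet> fst v\<close>, \<open>p = Q\<^sup>T w\<close>, is represented in the \<open>D\<close> inner
  product by \<open>z = F\<^sup>-\<^sup>1 (p, 0)\<close>, and \<open>|D z| = |R p|\<close>.\<close>

lemma norm_projection_le: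
  fixes F D :: "'a::euclidean_space \<times> 'b::euclidean_space \<Rightarrow> 'a \<times> 'b"
    and Q :: "'a \<Rightarrow> 'c::euclidean_space"
  assumes D: "is_pos_sqrt D F" and F: "bij F"
    and R: "is_pos_sqrt R (block_ff (inv F))" and Q: "linear Q"
  shows "norm (Q (fst v)) \<le> onorm (Q \<circ> R) * norm (D v)"
proof -
  note Dp = is_pos_sqrtD[OF D] and Rp = is_pos_sqrtD[OF R]
  note inv = inv_operator[OF Dp(2) F]
  have bl: "bounded_linear (Q \<circ> R)"
    using linear_compose[OF Rp(1) Q] by (simp add: linear_conv_bounded_linear)
  define w where "w = Q (fst v)"
  define p where "p = adjoint Q w"
  define z where "z = inv F (p, 0)"
  have Fz: "F z = (p, 0)" by (simp add: z_def inv(1))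
  have "norm w * norm w = p \<bullet> fst v"
    by (simp add: p_def adjoint_works[OF Q] w_def inner_commute flip: power2_norm_eq_inner power2_eq_square)
  also have "\<dots> = D z \<bullet> D v" using Dp(3)[of z v] by (cases v) (simp add: Fz)
  also have "\<dots> \<le> norm (D z) * norm (D v)" by (rule norm_cauchy_schwarz)
  finally have 1: "norm w * norm w \<le> norm (D z) * norm (D v)" .
  have "(norm (D z))\<^sup>2 = F z \<bullet> z" by (simp add: power2_norm_eq_inner Dp(3))
  also have "\<dots> = block_ff (inv F) p \<bullet> p"
    unfolding Fz by (cases z) (simp add: block_ff_def flip: z_def, simp add: inner_commute)
  finally have Dz: "norm (D z) = norm (R p)"
    by (simp add: Rp(3) flip: power2_norm_eq_inner)
  have "norm (R p) * norm (R p) = block_ff (inv F) p \<bullet> adjoint Q w"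
    by (simp add: Rp(3) flip: p_def power2_norm_eq_inner power2_eq_square)
  also have "\<dots> = (Q \<circ> R) (R p) \<bullet> w"
    using D R by (simp add: adjoint_works[OF Q] is_pos_sqrt_def fun_eq_iff)
  also have "\<dots> \<le> onorm (Q \<circ> R) * norm (R p) * norm w"
    using norm_cauchy_schwarz[of "(Q \<circ> R) (R p)" w] mult_right_mono[OF onorm[OF bl, of "R p"] norm_ge_zero[of w]]
    by linarith
  finally have 2: "norm (R p) \<le> onorm (Q \<circ> R) * norm w"
    using onorm_pos_le[OF bl] by (cases "R p = 0") (simp_all add: mult.commute mult.left_commute)
  have "norm w * norm w \<le> onorm (Q \<circ> R) * norm w * norm (D v)"
    using 1 mult_right_mono[OF 2 norm_ge_zero[of "D v"]] unfolding Dz by linarith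
  then show ?thesis
    unfolding w_def[symmetric] using onorm_pos_le[OF bl]
    by (cases "w = 0") (simp_all add: mult.commute mult.left_commute)
qed

section \<open>The penalised log-likelihood and the noise\<close>

lemma C_k_Phi:
  assumes "smooth A"
  shows "C_k k (Phi lam A)"
proof -
  have "C_k k A" using assms by (simp add: smooth_def)
  then have "C_k k (\<lambda>\<upsilon>. A (fst \<upsilon>))"
    by (rule C_k_compose_linear[OF bounded_linear.linear[OF bounded_linear_fst]])
  then have "C_k k (\<lambda>\<upsilon>. snd \<upsilon> - A (fst \<upsilon>))"
    by (rule C_k_diff[OF C_k_linear[OF bounded_linear.linear[OF bounded_linear_snd]]])
  then have "C_k k (\<lambda>\<upsilon>. (lam / 2) *\<^sub>R (norm (snd \<upsilon> - A (fst \<upsilon>)))\<^sup>2)"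
    by (intro C_k_scaleR C_k_norm_square)
  then show ?thesis by (simp add: Phi_def[abs_def])
qed

text \<open>A nested real supremum bounds its members only if the families are bounded above; this follows
  from the compactness of the two ellipsoids and the continuity of the third derivatives.\<close>

lemma dir_deriv_Phi_le_delta3:
  fixes A :: "'a::euclidean_space \<Rightarrow> 'b::euclidean_space"
  assumes A: "smooth A" and D: "linear D" "\<And>u. D u = 0 \<Longrightarrow> u = 0"
    and v: "norm (D (v - v0)) \<le> r" and u: "norm (D u) \<le> r"
  shows "\<bar>(dirder u ^^ 3) (Phi lam A) v\<bar> \<le> delta3 lam A D v0 r"
proof -
  let ?d = "\<lambda>v u. \<bar>dir_deriv 3 (Phi lam A) v u\<bar>"
  let ?V = "{v. norm (D (v - v0)) \<le> r}" and ?W = "{u. norm (D u) \<le> r}"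
  note eq = dir_deriv_eq_funpow_dirder[OF C_k_Phi[OF A]]
  have "compact ?W" using compact_ellipsoid[OF D, of 0] by simp
  then obtain R where R: "\<And>u. u \<in> ?W \<Longrightarrow> norm u \<le> R"
    using compact_imp_bounded bounded_iff by metis
  obtain c where c: "0 \<le> c" "\<And>v u. v \<in> ?V \<Longrightarrow> \<bar>(dirder u ^^ 3) (Phi lam A) v\<bar> \<le> c * norm u ^ 3"
    using funpow_dirder_bounded_on_compact[OF compact_ellipsoid[OF D] C_k_Phi[OF A]]
    unfolding real_norm_def by metis
  have le: "?d v u \<le> c * R ^ 3" if "v \<in> ?V" "u \<in> ?W" for v u
  proof -
    have "c * norm u ^ 3 \<le> c * R ^ 3"
      using R[OF that(2)] c(1) by (intro mult_left_mono power_mono) auto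
    then show ?thesis using c(2)[OF that(1), of u] by (simp add: eq)
  qed
  have "?d v u \<le> (SUP u\<in>?W. ?d v u)"
    using u v le by (intro cSUP_upper bdd_aboveI2[of _ _ "c * R ^ 3"]) auto
  also have "\<dots> \<le> (SUP v\<in>?V. SUP u\<in>?W. ?d v u)"
  proof (intro cSUP_upper bdd_aboveI2)
    show "(SUP u\<in>?W. ?d v u) \<le> c * R ^ 3" if "v \<in> ?V" for v
      using u le[OF that] by (intro cSUP_least) blast+
  qed (use v in simp)
  finally show ?thesis by (simp add: delta3_def eq)
qed

text \<open>The criterion is quadratic in the data with a leading term that is free of the parameter. Hence a
  perturbation of the data acts on the parameter only through a linear functional of its second
  component.\<close>

lemma pen_log_lik_shift_data:
  assumes "\<sigma> > 0"
  shows "pen_log_lik \<sigma> lam A G f0 \<Gamma> g0 (y0 + \<sigma> *\<^sub>R e) \<upsilon>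
    = pen_log_lik \<sigma> lam A G f0 \<Gamma> g0 y0 \<upsilon> + (1 / \<sigma>) * (e \<bullet> (snd \<upsilon> - y0)) - (norm e)\<^sup>2 / 2"
proof -
  have "(norm (y0 + \<sigma> *\<^sub>R e - snd \<upsilon>))\<^sup>2
      = (norm (y0 - snd \<upsilon>))\<^sup>2 - 2 * \<sigma> * (e \<bullet> (snd \<upsilon> - y0)) + \<sigma>\<^sup>2 * (norm e)\<^sup>2"
    unfolding power2_norm_eq_inner
    by (simp add: inner_simps inner_commute algebra_simps power2_eq_square)
  then show ?thesis
    using assms by (simp add: pen_log_lik_def log_lik_def field_simps power2_eq_square)
qed

text \<open>The data misfit and both penalties are collected into one square of an affine map, so that the
  third derivatives of the criterion are those of \<open>- Phi lam A\<close>.\<close>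

lemma pen_log_lik_eq_Phi_plus_square:
  assumes "\<sigma> > 0" "linear G" "linear \<Gamma>"
  obtains L c where "linear (L :: 'a::euclidean_space \<times> 'b::euclidean_space \<Rightarrow> 'b \<times> 'a \<times> 'b)"
    "pen_log_lik \<sigma> lam A G f0 \<Gamma> g0 y = (\<lambda>\<upsilon>. - Phi lam A \<upsilon> - (norm (L \<upsilon> + c))\<^sup>2 / 2)"
proof
  let ?L = "\<lambda>\<upsilon>::'a \<times> 'b. ((1 / \<sigma>) *\<^sub>R snd \<upsilon>, G (fst \<upsilon>), \<Gamma> (snd \<upsilon>))"
  let ?c = "(- (1 / \<sigma>) *\<^sub>R y, - G f0, - \<Gamma> g0)"
  show "linear ?L"
    by (rule linearI) (simp_all add: linear_add[OF assms(2)] linear_add[OF assms(3)]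
        linear_cmul[OF assms(2)] linear_cmul[OF assms(3)] algebra_simps)
  have sq: "(norm (p, q, s))\<^sup>2 = (norm p)\<^sup>2 + (norm q)\<^sup>2 + (norm s)\<^sup>2" for p s :: 'b and q :: 'a
    by (simp add: power2_norm_eq_inner)
  have "(norm ((1 / \<sigma>) *\<^sub>R g + - (1 / \<sigma>) *\<^sub>R y))\<^sup>2 = (1 / \<sigma>\<^sup>2) * (norm (y - g))\<^sup>2" for g
  proof -
    have "(1 / \<sigma>) *\<^sub>R g + - (1 / \<sigma>) *\<^sub>R y = (1 / \<sigma>) *\<^sub>R (g - y)" by (simp add: algebra_simps)
    then show ?thesis by (simp add: power_divide norm_minus_commute)
  qed
  then have "(norm (?L \<upsilon> + ?c))\<^sup>2
      = (1 / \<sigma>\<^sup>2) * (norm (y - snd \<upsilon>))\<^sup>2 + (norm (G (fst \<upsilon> - f0)))\<^sup>2 + (norm (\<Gamma> (snd \<upsilon> - g0)))\<^sup>2" for \<upsilon>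
    by (simp add: sq linear_diff[OF assms(2)] linear_diff[OF assms(3)])
  then show "pen_log_lik \<sigma> lam A G f0 \<Gamma> g0 y = (\<lambda>\<upsilon>. - Phi lam A \<upsilon> - (norm (?L \<upsilon> + ?c))\<^sup>2 / 2)"
    by (intro ext) (simp add: pen_log_lik_def log_lik_def Phi_def field_simps)
qed

text \<open>The normalised direction in the condition is removed by choosing \<open>t = |S u|\<close>.\<close>

lemma cond_ES_mgf:
  assumes ES: "cond_ES M eps S \<nu>0 \<infinity>" and M: "prob_space M"
  shows "(\<integral>\<^sup>+\<omega>. ennreal (exp (u \<bullet> eps \<omega>)) \<partial>M) \<le> ennreal (exp (\<nu>0\<^sup>2 * (norm (S u))\<^sup>2 / 2))"
proof (cases "u = 0")
  case True
  interpret prob_space M by fact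
  show ?thesis using True by (simp add: emeasure_space_1)
next
  case False
  then have "0 < u \<bullet> S u" using ES by (simp add: cond_ES_def pos_def_def)
  then have Su: "norm (S u) \<noteq> 0" by auto
  note ES[unfolded cond_ES_def, THEN conjunct2, THEN conjunct2, THEN conjunct2, THEN conjunct2,
      THEN conjunct2, rule_format, OF False, of "norm (S u)"]
  then have int: "integrable M (\<lambda>\<omega>. exp (u \<bullet> eps \<omega>))"
    and ln: "ln (\<integral>\<omega>. exp (u \<bullet> eps \<omega>) \<partial>M) \<le> \<nu>0\<^sup>2 * (norm (S u))\<^sup>2 / 2" (is "ln ?I \<le> ?c")
    using Su by simp_all
  have "?I \<le> exp ?c"
  proof (cases "0 < ?I")
    case True
    then have "?I = exp (ln ?I)" by simp
    also have "\<dots> \<le> exp ?c" using ln by (simp only: exp_le_cancel_iff)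
    finally show ?thesis .
  next
    case False
    then show ?thesis using exp_ge_zero[of ?c] by linarith
  qed
  then show ?thesis
    by (subst nn_integral_eq_integral[OF int]) (simp_all add: ennreal_leI)
qed

section \<open>Expansion of the penalised maximum likelihood estimator\<close>

theorem corollary4p3:
  fixes M :: "'w measure"
    and Y eps :: "'w \<Rightarrow> 'b::euclidean_space"
    and A :: "'a::euclidean_space \<Rightarrow> 'b"
    and \<sigma> lam \<nu>0 C n x rG \<rho> :: real
    and fstar f0 :: 'a and g0 :: 'b
    and G :: "'a \<Rightarrow> 'a" and \<Gamma> S HGinv BS :: "'b \<Rightarrow> 'b"
    and EL ELG :: "'a \<times> 'b \<Rightarrow> real"
    and Uo U0 V :: "('a \<times> 'b) set"
    and \<upsilon>tilde :: "'w \<Rightarrow> 'a \<times> 'b" and \<upsilon>s :: "'a \<times> 'b"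
    and FG DG :: "'a \<times> 'b \<Rightarrow> 'a \<times> 'b"
    and AG :: "'b \<Rightarrow> 'a" and DDinv :: "'a \<Rightarrow> 'a"
    and \<Omega> :: "'w set"
    and Q :: "'a \<Rightarrow> real ^ 'm" and BQ :: "real ^ 'm \<Rightarrow> real ^ 'm"
  assumes M: "prob_space M"
    and A: "smooth A" and \<sigma>: "\<sigma> > 0" and lam: "lam > 0"
    and Y: "Y \<in> borel_measurable M" "integrable M Y" "(\<integral>\<omega>. Y \<omega> \<partial>M) = A fstar"
    and eps: "eps = (\<lambda>\<omega>. (1 / \<sigma>) *\<^sub>R (Y \<omega> - (\<integral>\<omega>'. Y \<omega>' \<partial>M)))"
    and prior: "pos_semidef G" "pos_semidef \<Gamma>"
    and EL: "EL = (\<lambda>\<upsilon>. \<integral>\<omega>. log_lik \<sigma> lam A (Y \<omega>) \<upsilon> \<partial>M)"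
    and ELG: "ELG = (\<lambda>\<upsilon>. \<integral>\<omega>. pen_log_lik \<sigma> lam A G f0 \<Gamma> g0 (Y \<omega>) \<upsilon> \<partial>M)"
    and U0: "U0 \<subseteq> Uo"
    and pMLE: "\<And>\<omega>. \<omega> \<in> space M \<Longrightarrow>
        \<exists>\<upsilon>. is_arg_max (pen_log_lik \<sigma> lam A G f0 \<Gamma> g0 (Y \<omega>)) (\<lambda>\<upsilon>. \<upsilon> \<in> Uo) \<upsilon> \<Longrightarrow>
        is_arg_max (pen_log_lik \<sigma> lam A G f0 \<Gamma> g0 (Y \<omega>)) (\<lambda>\<upsilon>. \<upsilon> \<in> Uo) (\<upsilon>tilde \<omega>)"
    and \<upsilon>s: "is_arg_max ELG (\<lambda>\<upsilon>. \<upsilon> \<in> Uo) \<upsilon>s"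
    and FG: "FG = (\<lambda>u. - hessian ELG \<upsilon>s u)" "bij FG"
    and DG: "is_pos_sqrt DG FG"
    and DDinv: "is_pos_sqrt DDinv (block_ff (inv FG))"
    and AG: "AG = block_fg (inv FG)"
    and HGinv: "HGinv = block_gg (inv FG)"
    and cond_L: "cond_L Uo ELG"
    and cond_ES: "cond_ES M eps S \<nu>0 \<infinity>"
    and cond_GGamma: "cond_GGamma \<sigma> A G f0 \<Gamma> g0 fstar
        (block_ff FG) (block_ff (\<lambda>u. - hessian EL \<upsilon>s u)) C"
    and cond_L0: "cond_L0 A U0 V"
    and n: "n \<ge> 1" and x: "x = ln n"
    and BS: "BS = (\<lambda>y. (1 / \<sigma>\<^sup>2) *\<^sub>R S (HGinv (S y)))"
    and \<Omega>: "\<Omega> \<in> sets M" "measure M \<Omega> \<ge> 1 - exp (- x)"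
        "\<And>\<omega>. \<omega> \<in> \<Omega> \<Longrightarrow> (1 / \<sigma>\<^sup>2) * (eps \<omega> \<bullet> HGinv (eps \<omega>)) \<le> (zq BS x)\<^sup>2"
    and rG: "{\<upsilon>. norm (DG (\<upsilon> - \<upsilon>s)) \<le> rG} \<subseteq> U0"
        "3 * delta3 lam A DG \<upsilon>s rG / rG\<^sup>2 \<le> \<rho>" "\<rho> \<le> 1 / 2"
        "(1 - \<rho>) * rG \<ge> zq BS x"
    and Q: "linear Q"
    and BQ: "BQ = (\<lambda>w. (1 / \<sigma>\<^sup>2) *\<^sub>R Q (AG (S (S (adjoint AG (adjoint Q w))))))"
  shows "\<exists>\<Omega>1\<in>sets M. measure M \<Omega>1 \<ge> 1 - 2 / n \<and>
      (\<forall>\<omega>\<in>\<Omega>1. norm (Q (fst (\<upsilon>tilde \<omega>) - fst \<upsilon>s))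
          \<le> \<nu>0 * zq BQ x + onorm (Q \<circ> DDinv) * sqrt (delta3 lam A DG \<upsilon>s rG))"
proof -
  interpret prob_space M by fact
  define y0 where "y0 = A fstar"
  define pen where "pen = pen_log_lik \<sigma> lam A G f0 \<Gamma> g0"
  define e2 where "e2 = (\<integral>\<omega>. (norm (eps \<omega>))\<^sup>2 \<partial>M)"
  note D = is_pos_sqrtD[OF DG]
  note D_inj = bij_pos_sqrt_inj[OF DG FG(2)]
  note inv = inv_operator[OF D(2) FG(2)]
  have [measurable]: "Y \<in> borel_measurable M" by (rule Y(1))
  have eps_meas [measurable]: "eps \<in> borel_measurable M" unfolding eps by measurable
  have eps_int: "integrable M eps" unfolding eps using Y(2) by simp
  have eps_mean: "(\<integral>\<omega>. eps \<omega> \<partial>M) = 0" unfolding eps using Y(2) by (simp add: prob_space)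
  have e2_int: "integrable M (\<lambda>\<omega>. (norm (eps \<omega>))\<^sup>2)" using cond_ES by (simp add: cond_ES_def)
  have Y_eps: "Y \<omega> = y0 + \<sigma> *\<^sub>R eps \<omega>" for \<omega>
    using \<sigma> by (simp add: eps Y(3) y0_def)
  have pen_Y: "pen (Y \<omega>) \<upsilon> = pen y0 \<upsilon> + (1 / \<sigma>) * (eps \<omega> \<bullet> (snd \<upsilon> - y0)) - (norm (eps \<omega>))\<^sup>2 / 2" for \<omega> \<upsilon>
    unfolding pen_def Y_eps by (rule pen_log_lik_shift_data[OF \<sigma>])
  have ELG_pen: "ELG \<upsilon> = pen y0 \<upsilon> - e2 / 2" for \<upsilon>
  proof -
    have "ELG \<upsilon> = (\<integral>\<omega>. pen y0 \<upsilon> + (1 / \<sigma>) * (eps \<omega> \<bullet> (snd \<upsilon> - y0)) - (norm (eps \<omega>))\<^sup>2 / 2 \<partial>M)"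
      unfolding ELG pen_def[symmetric] pen_Y ..
    also have "\<dots> = pen y0 \<upsilon> + (1 / \<sigma>) * ((\<integral>\<omega>. eps \<omega> \<partial>M) \<bullet> (snd \<upsilon> - y0)) - e2 / 2"
      using eps_int e2_int by (simp add: e2_def prob_space)
    finally show ?thesis by (simp add: eps_mean)
  qed
  \<comment> \<open>The noise enters the criterion only through a linear functional of \<open>\<upsilon>\<close>.\<close>
  define a where "a \<omega> = ((0::'a), (1 / \<sigma>) *\<^sub>R eps \<omega>)" for \<omega>
  have pen_tilt: "pen (Y \<omega>) \<upsilon> = (ELG \<upsilon> + a \<omega> \<bullet> \<upsilon>) + (e2 / 2 - (norm (eps \<omega>))\<^sup>2 / 2 - (1 / \<sigma>) * (eps \<omega> \<bullet> y0))" for \<omega> \<upsilon>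
    unfolding pen_Y ELG_pen by (cases \<upsilon>) (simp add: a_def inner_simps right_diff_distrib)
  have linG: "linear G" and lin\<Gamma>: "linear \<Gamma>" using prior by (simp_all add: pos_semidef_def self_adjoint_def)
  obtain L :: "'a \<times> 'b \<Rightarrow> 'b \<times> 'a \<times> 'b" and c where L: "linear L"
    and pen_sq: "pen y0 = (\<lambda>\<upsilon>. - Phi lam A \<upsilon> - (norm (L \<upsilon> + c))\<^sup>2 / 2)"
    unfolding pen_def by (rule pen_log_lik_eq_Phi_plus_square[OF \<sigma> linG lin\<Gamma>])
  let ?N = "\<lambda>\<upsilon>. (norm (L \<upsilon> + c))\<^sup>2 + e2"
  have ELG_eq: "ELG = (\<lambda>\<upsilon>. (- 1) *\<^sub>R Phi lam A \<upsilon> + (- 1 / 2) *\<^sub>R ?N \<upsilon>)"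
    by (rule ext) (simp add: ELG_pen pen_sq field_simps)
  have N: "C_k 3 ?N"
    by (intro C_k_add C_k_norm_square C_k_linear L C_k_const)
  have smooth_ELG: "C_k 3 ELG"
    unfolding ELG_eq by (intro C_k_add C_k_scaleR N C_k_Phi A)
  have third: "(dirder u ^^ 3) ELG \<upsilon> = - (dirder u ^^ 3) (Phi lam A) \<upsilon>" for u \<upsilon>
    unfolding ELG_eq funpow_dirder_combination[OF C_k_Phi[OF A] N]
      third_dirder_norm_square_affine[OF L] by simp
  have curvature: "dirder u (dirder u ELG) \<upsilon>s = - (norm (DG u))\<^sup>2" for u
  proof -
    have "dirder u (dirder u ELG) \<upsilon>s = u \<bullet> hessian ELG \<upsilon>s u"
      using smooth_ELG by (subst inner_hessian[where k = 1]) (simp_all add: eval_nat_numeral)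
    also have "\<dots> = - (FG u \<bullet> u)" by (simp add: FG(1) inner_commute)
    finally show ?thesis by (simp add: D(3) power2_norm_eq_inner)
  qed
  have DGzero: "DG 0 = 0" using D(1) by (rule linear_0)
  have Finv_pos: "0 < z \<bullet> inv FG z" if "z \<noteq> 0" for z
  proof -
    have "z \<bullet> inv FG z = (norm (DG (inv FG z)))\<^sup>2"
      using D(3)[of "inv FG z" "inv FG z"] by (simp add: inv(1) power2_norm_eq_inner)
    moreover have "DG (inv FG z) \<noteq> 0"
      using D_inj[of "inv FG z"] inv(1)[of z] linear_0[of FG] D(2) that by (auto simp: self_adjoint_def)
    ultimately show ?thesis by simp
  qed
  \<comment> \<open>The block of a symmetric positive definite operator inherits these properties.\<close>
  have H_sa: "self_adjoint HGinv"
    unfolding self_adjoint_def HGinv block_gg_def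
  proof (intro conjI allI)
    show "linear (\<lambda>y. snd (inv FG (0, y)))"
      by (rule linearI) (simp_all flip: snd_add snd_scaleR linear_add[OF inv(2)] linear_cmul[OF inv(2)])
    show "snd (inv FG (0, y)) \<bullet> y' = y \<bullet> snd (inv FG (0, y'))" for y y'
      using inv(3)[of "(0, y)" "(0, y')"] by (cases "inv FG (0, y)"; cases "inv FG (0, y')") simp
  qed
  have H_pos: "0 < y \<bullet> HGinv y" if "y \<noteq> 0" for y
    using Finv_pos[of "(0, y)"] that by (cases "inv FG (0, y)") (simp add: HGinv block_gg_def zero_prod_def)
  have S: "linear S" "S y' \<bullet> y = y' \<bullet> S y" "y \<noteq> 0 \<Longrightarrow> S y \<noteq> 0" for y y'
  proof -
    have "pos_def S" using cond_ES by (simp add: cond_ES_def)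
    then show "linear S" "S y' \<bullet> y = y' \<bullet> S y" "y \<noteq> 0 \<Longrightarrow> S y \<noteq> 0"
      by (auto simp: pos_def_def self_adjoint_def)
  qed
  have linH: "linear HGinv" using H_sa by (simp add: self_adjoint_def)
  have BS_inner: "y' \<bullet> BS y = (1 / \<sigma>\<^sup>2) * (S y' \<bullet> HGinv (S y))" for y y'
    by (simp add: BS S(2))
  have BS_psd: "pos_semidef BS"
    unfolding pos_semidef_def self_adjoint_def
  proof (intro conjI allI)
    show "linear BS"
      unfolding BS by (rule linearI) (simp_all add: linear_add[OF S(1)] linear_add[OF linH]
          linear_cmul[OF S(1)] linear_cmul[OF linH] scaleR_right_distrib)
    show "BS y \<bullet> y' = y \<bullet> BS y'" for y y'
      using H_sa unfolding inner_commute[of "BS y"] BS_inner self_adjoint_def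
      by (metis inner_commute)
    show "0 \<le> y \<bullet> BS y" for y
      unfolding BS_inner using H_pos[of "S y"] by (cases "S y = 0") (auto simp: less_imp_le)
  qed
  have x0: "0 \<le> x" and ex: "exp (- x) = 1 / n"
    using n by (simp_all add: x exp_minus inverse_eq_divide)
  \<comment> \<open>The trace of \<open>BS\<close> is strictly positive, which excludes the degenerate radius \<open>rG = 0\<close>.\<close>
  have zBS: "0 < zq BS x"
  proof -
    have "0 < op_trace BS"
      unfolding op_trace_def BS_inner
      using H_pos S(3) \<sigma> nonzero_Basis by (intro sum_pos) (auto intro!: divide_pos_pos)
    moreover have "0 \<le> lambda_max BS" by (rule lambda_max_nonneg[OF BS_psd])
    ultimately show ?thesis using x0 unfolding zq_def by (intro add_pos_nonneg) auto
  qed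
  have r: "0 < rG"
  proof (rule zero_less_mult_pos[of "1 - \<rho>"])
    show "0 < (1 - \<rho>) * rG" using zBS rG(4) by linarith
  qed (use rG(3) in simp)
  define u0 where "u0 \<omega> = inv FG (a \<omega>)" for \<omega>
  have tilt: "a \<omega> \<bullet> u = DG (u0 \<omega>) \<bullet> DG u" for \<omega> u
    using D(3)[of "u0 \<omega>" u] by (simp add: u0_def inv(1))
  have tilt_small: "norm (DG (u0 \<omega>)) \<le> (1 - \<rho>) * rG" if "\<omega> \<in> \<Omega>" for \<omega>
  proof -
    have "(norm (DG (u0 \<omega>)))\<^sup>2 = a \<omega> \<bullet> u0 \<omega>"
      by (simp add: tilt power2_norm_eq_inner)
    also have "\<dots> = ((1 / \<sigma>) *\<^sub>R eps \<omega>) \<bullet> HGinv ((1 / \<sigma>) *\<^sub>R eps \<omega>)"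
      by (cases "u0 \<omega>") (simp add: a_def u0_def HGinv block_gg_def)
    also have "\<dots> = (1 / \<sigma>\<^sup>2) * (eps \<omega> \<bullet> HGinv (eps \<omega>))"
      by (simp add: linear_cmul[OF linH] power2_eq_square)
    also have "\<dots> \<le> (zq BS x)\<^sup>2" using that by (rule \<Omega>(3))
    finally have "norm (DG (u0 \<omega>)) \<le> zq BS x"
      using zBS by (rule power2_le_imp_le[OF _ less_imp_le])
    then show ?thesis using rG(4) by linarith
  qed
  have tcm: "tilted_concave_maximum ELG Uo \<upsilon>s (a \<omega>) (u0 \<omega>) DG rG \<rho> (delta3 lam A DG \<upsilon>s rG)"
    if "\<omega> \<in> \<Omega>" for \<omega>
  proof (rule tilted_concave_maximum.intro)
    show "open Uo" "concave_on Uo ELG" using cond_L by (simp_all add: cond_L_def)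
    show "{v. norm (DG (v - \<upsilon>s)) \<le> rG} \<subseteq> Uo" using rG(1) U0 by blast
    show "\<bar>(dirder u ^^ 3) ELG v\<bar> \<le> delta3 lam A DG \<upsilon>s rG"
      if "norm (DG (v - \<upsilon>s)) \<le> rG" "norm (DG u) \<le> rG" for u v
      unfolding third abs_minus_cancel by (rule dir_deriv_Phi_le_delta3[OF A D(1) D_inj that])
  qed (assumption | rule smooth_ELG \<upsilon>s D(1) D_inj curvature r rG(2) rG(3) tilt tilt_small[OF that])+
  have near: "norm (DG (\<upsilon>tilde \<omega> - \<upsilon>s - u0 \<omega>)) \<le> sqrt (delta3 lam A DG \<upsilon>s rG)"
    if \<omega>: "\<omega> \<in> \<Omega>" for \<omega>
  proof -
    interpret tilted_concave_maximum ELG Uo \<upsilon>s "a \<omega>" "u0 \<omega>" DG rG \<rho> "delta3 lam A DG \<upsilon>s rG"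
      by (rule tcm[OF \<omega>])
    have same: "is_arg_max (pen (Y \<omega>)) (\<lambda>\<upsilon>. \<upsilon> \<in> Uo) \<upsilon> \<longleftrightarrow> is_arg_max tilted (\<lambda>\<upsilon>. \<upsilon> \<in> Uo) \<upsilon>" for \<upsilon>
      by (simp add: is_arg_max_def pen_tilt tilted_def)
    have "\<omega> \<in> space M" using \<omega> \<Omega>(1) sets.sets_into_space by blast
    then have "is_arg_max tilted (\<lambda>\<upsilon>. \<upsilon> \<in> Uo) (\<upsilon>tilde \<omega>)"
      using pMLE[of \<omega>] tilted_maximum_exists unfolding pen_def[symmetric] same by blast
    then show ?thesis
      using tilted_maximum_near_newton_step real_le_rsqrt by blast
  qed
  \<comment> \<open>The image of the Newton step is a linear function of the noise.\<close>
  define \<xi> where "\<xi> \<omega> = Q (fst (u0 \<omega>))" for \<omega>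
  have linAG: "linear AG"
    unfolding AG block_fg_def
    by (rule linearI) (simp_all flip: fst_add fst_scaleR linear_add[OF inv(2)] linear_cmul[OF inv(2)])
  define P where "P w = S (adjoint AG (adjoint Q w))" for w
  have linP: "linear P"
    unfolding P_def
    using linear_compose[OF linear_compose[OF adjoint_linear[OF Q] adjoint_linear[OF linAG]] S(1)]
    by (simp add: o_def)
  have \<xi>_eps: "\<xi> \<omega> = (1 / \<sigma>) *\<^sub>R Q (AG (eps \<omega>))" for \<omega>
  proof -
    have "fst (u0 \<omega>) = AG ((1 / \<sigma>) *\<^sub>R eps \<omega>)" by (simp add: u0_def a_def AG block_fg_def)
    then show ?thesis by (simp add: \<xi>_def linear_cmul[OF linAG] linear_cmul[OF Q])
  qed
  have "linear (Q \<circ> AG)" by (rule linear_compose[OF linAG Q])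
  then have "(\<lambda>y. Q (AG y)) \<in> borel_measurable borel"
    by (intro borel_measurable_continuous_onI linear_continuous_on) (simp add: linear_conv_bounded_linear o_def)
  then have \<xi>_meas [measurable]: "\<xi> \<in> borel_measurable M"
    unfolding \<xi>_eps[abs_def] by measurable
  \<comment> \<open>The adjoints in \<open>BQ\<close> make it a Gram operator, \<open>BQ = \<sigma>\<^sup>-\<^sup>2 P\<^sup>T P\<close>.\<close>
  have BQ_inner: "w' \<bullet> BQ w = (1 / \<sigma>\<^sup>2) * (P w' \<bullet> P w)" for w w'
  proof -
    have "P w' \<bullet> P w = adjoint AG (adjoint Q w') \<bullet> S (P w)" unfolding P_def by (rule S(2))
    also have "\<dots> = AG (S (P w)) \<bullet> adjoint Q w'"
      unfolding adjoint_works[OF linAG, symmetric] by (rule inner_commute)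
    also have "\<dots> = w' \<bullet> Q (AG (S (P w)))"
      unfolding adjoint_works[OF Q] by (rule inner_commute)
    finally show ?thesis by (simp add: BQ P_def)
  qed
  have BQ_psd: "pos_semidef BQ"
    unfolding pos_semidef_def self_adjoint_def
  proof (intro conjI allI)
    have "BQ = (\<lambda>w. (1 / \<sigma>\<^sup>2) *\<^sub>R Q (AG (S (P w))))" by (simp add: BQ P_def)
    then show "linear BQ"
      using linP linAG Q S(1) by (auto intro!: linearI simp: linear_add linear_cmul scaleR_right_distrib)
    show "BQ w \<bullet> w' = w \<bullet> BQ w'" for w w'
      unfolding inner_commute[of "BQ w"] BQ_inner by (simp add: inner_commute)
    show "0 \<le> w \<bullet> BQ w" for w unfolding BQ_inner by simp
  qed
  have \<nu>: "1 \<le> \<nu>0" using cond_ES by (simp add: cond_ES_def)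
  \<comment> \<open>Dividing by \<open>\<nu>0\<close> normalises the sub-Gaussian bound to the matrix \<open>BQ\<close>; this is the origin of
    the factor \<open>\<nu>0\<close> in the final bound.\<close>
  have mgf: "(\<integral>\<^sup>+\<omega>. ennreal (exp (w \<bullet> ((1 / \<nu>0) *\<^sub>R \<xi> \<omega>))) \<partial>M) \<le> ennreal (exp (w \<bullet> BQ w / 2))" for w
  proof -
    define u where "u = (1 / (\<nu>0 * \<sigma>)) *\<^sub>R adjoint AG (adjoint Q w)"
    have "w \<bullet> ((1 / \<nu>0) *\<^sub>R \<xi> \<omega>) = u \<bullet> eps \<omega>" for \<omega>
      by (simp add: \<xi>_eps u_def adjoint_works[OF Q] adjoint_works[OF linAG] inner_commute)
    moreover have "\<nu>0\<^sup>2 * (norm (S u))\<^sup>2 = w \<bullet> BQ w"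
      using \<nu> by (simp add: u_def linear_cmul[OF S(1)] BQ_inner P_def power_divide power_mult_distrib
          flip: power2_norm_eq_inner)
    ultimately show ?thesis using cond_ES_mgf[OF cond_ES M, of u] by simp
  qed
  define \<Omega>' where "\<Omega>' = {\<omega> \<in> space M. norm (\<xi> \<omega>) \<le> \<nu>0 * zq BQ x}"
  have [measurable]: "\<Omega>' \<in> sets M" unfolding \<Omega>'_def by measurable
  have "1 - exp (- x) \<le> prob {\<omega> \<in> space M. norm ((1 / \<nu>0) *\<^sub>R \<xi> \<omega>) \<le> zq BQ x}"
    by (rule subgaussian_norm_deviation[OF M _ BQ_psd mgf x0]) measurable
  also have "{\<omega> \<in> space M. norm ((1 / \<nu>0) *\<^sub>R \<xi> \<omega>) \<le> zq BQ x} = \<Omega>'"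
    using \<nu> by (auto simp: \<Omega>'_def field_simps)
  finally have \<Omega>': "1 - exp (- x) \<le> prob \<Omega>'" .
  have "1 - 2 / n \<le> prob (\<Omega> \<inter> \<Omega>')"
  proof -
    have "prob (\<Omega> \<union> \<Omega>') = prob \<Omega> + prob \<Omega>' - prob (\<Omega> \<inter> \<Omega>')"
      using \<Omega>(1) by (intro measure_Un3) (auto simp: fmeasurable_eq_sets)
    moreover have "prob (\<Omega> \<union> \<Omega>') \<le> 1" by (rule prob_le_1)
    ultimately show ?thesis using \<Omega>(2) \<Omega>' unfolding ex by simp
  qed
  moreover have "norm (Q (fst (\<upsilon>tilde \<omega>) - fst \<upsilon>s))
      \<le> \<nu>0 * zq BQ x + onorm (Q \<circ> DDinv) * sqrt (delta3 lam A DG \<upsilon>s rG)" if "\<omega> \<in> \<Omega> \<inter> \<Omega>'" for \<omega>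
  proof -
    define v where "v = \<upsilon>tilde \<omega> - \<upsilon>s - u0 \<omega>"
    have bl: "bounded_linear (Q \<circ> DDinv)"
      using linear_compose[OF is_pos_sqrtD(1)[OF DDinv] Q] by (simp add: linear_conv_bounded_linear)
    have "fst (\<upsilon>tilde \<omega>) - fst \<upsilon>s = fst (u0 \<omega>) + fst v" by (simp add: v_def)
    then have "Q (fst (\<upsilon>tilde \<omega>) - fst \<upsilon>s) = \<xi> \<omega> + Q (fst v)"
      by (simp add: \<xi>_def linear_add[OF Q])
    then have "norm (Q (fst (\<upsilon>tilde \<omega>) - fst \<upsilon>s)) \<le> norm (\<xi> \<omega>) + norm (Q (fst v))"
      by (simp add: norm_triangle_ineq)
    also have "norm (Q (fst v)) \<le> onorm (Q \<circ> DDinv) * norm (DG v)"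
      by (rule norm_projection_le[OF DG FG(2) DDinv Q])
    also have "\<dots> \<le> onorm (Q \<circ> DDinv) * sqrt (delta3 lam A DG \<upsilon>s rG)"
      using near[of \<omega>] that onorm_pos_le[OF bl] unfolding v_def by (intro mult_left_mono) auto
    finally show ?thesis using that by (simp add: \<Omega>'_def)
  qed
  ultimately show ?thesis using \<Omega>(1) by (intro bexI[of _ "\<Omega> \<inter> \<Omega>'"]) auto
qed

end
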